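(* For all $k\ge 1$, $\hat K_k \in \mathcal{G}$.
   Context: $\mathbb{N}=\{0,1,2,\ldots\}$. For a finite set (alphabet) $\Sigma$, the full shift $\Sigma^{\mathbb{Z}}$ carries the product topology and the shift homeomorphism $\sigma(x)_i = x_{i+1}$. $\mathrm{Aut}(\Sigma^{\mathbb{Z}})$ is the group of homeomorphisms of $\Sigma^{\mathbb{Z}}$ commuting with $\sigma$. $\mathcal{G}$ is the class of groups that embed (as abstract groups) in $\mathrm{Aut}(\Sigma^{\mathbb{Z}})$, where $\Sigma$ is a finite alphabet with at least two elements; it is known that this class does not depend on the choice of such $\Sigma$. For a group $H$ acting on a set $\Omega$ and a group $A$, $A\wr_\Omega H$ is the (restricted) permutational wreath product $A^{(\Omega)}\rtimes H$, where $A^{(\Omega)}$ is the group of finitely supported functions $\Omega\to A$ on which $H$ acts by permuting coordinates. For $n\in\mathbb{N}$ let $K_1^n=\mathbb{Z}/n\mathbb{Z}$ (so $K_1^0=\mathbb{Z}$), acting on $\mathbb{Z}/n\mathbb{Z}$ by translation. Inductively, given the action of $K_k^n$ on $(\mathbb{Z}/n\mathbb{Z})^k$, let $K_{k+1}^n=\mathbb{Z}/n\mathbb{Z}\wr_{(\mathbb{Z}/n\mathbb{Z})^k}K_k^n$, acting on $(\mathbb{Z}/n\mathbb{Z})^{k+1}$ as follows: the top group $K_k^n$ acts on the first $k$ coordinates by its given action, and the generator of the base (the function with value $1$ at $(0,\ldots,0)$ and $0$ elsewhere) adds $1$ to the last coordinate if all other coordinates are $0$, and otherwise does nothing. The group $K_k^n$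 has the natural generators $g_1,\ldots,g_k$, where $g_i$ adds $1$ to the $i$th coordinate if coordinates $1,\ldots,i-1$ are all $0$ (in $\mathbb{Z}/n\mathbb{Z}$), and otherwise does nothing. $\hat K_k$ is the group generated by $k$ elements $g_1,\ldots,g_k$ whose relations are precisely those relations (words in $g_1^{\pm1},\ldots,g_k^{\pm1}$) that hold in $K_k^n$ for all $n\in\mathbb{N}$; equivalently, it is the subgroup of $\prod_{n\in\mathbb{N}}K_k^n$ generated by the diagonal elements $(g_i,g_i,g_i,\ldots)$, $1\le i\le k$. *)

theory Defs
  imports "HOL-Analysis.Analysis" "HOL-Algebra.Algebra"
begin

section \<open>Automorphism groups of full shifts\<close>

definition full_shift :: "'a set \<Rightarrow> (int \<Rightarrow> 'a) topology" where
  "full_shift \<Sigma> = product_topology (\<lambda>_. discrete_topology \<Sigma>) UNIV"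

definition shift :: "(int \<Rightarrow> 'a) \<Rightarrow> int \<Rightarrow> 'a" where
  "shift x = (\<lambda>i. x (i + 1))"

definition shift_aut :: "'a set \<Rightarrow> ((int \<Rightarrow> 'a) \<Rightarrow> int \<Rightarrow> 'a) set" where
  "shift_aut \<Sigma> = {f \<in> Bij (topspace (full_shift \<Sigma>)).
     homeomorphic_map (full_shift \<Sigma>) (full_shift \<Sigma>) f \<and>
     (\<forall>x \<in> topspace (full_shift \<Sigma>). f (shift x) = shift (f x))}"

definition ShiftAutGroup :: "'a set \<Rightarrow> ((int \<Rightarrow> 'a) \<Rightarrow> int \<Rightarrow> 'a) monoid" where
  "ShiftAutGroup \<Sigma> = BijGroup (topspace (full_shift \<Sigma>)) \<lparr>carrier := shift_aut \<Sigma>\<rparr>"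

text \<open>The class of groups that embed in the automorphism group of a full shift on a finite alphabet
  with at least two symbols.  Taking the alphabet among the finite sets of natural numbers is no
  restriction, as only its cardinality matters.\<close>

definition embeds_in_shift_aut :: "('g, 'm) monoid_scheme \<Rightarrow> bool" where
  "embeds_in_shift_aut G \<longleftrightarrow> group G \<and>
     (\<exists>\<Sigma> :: nat set. finite \<Sigma> \<and> card \<Sigma> \<ge> 2 \<and> mon G (ShiftAutGroup \<Sigma>) \<noteq> {})"


section \<open>Permutational wreath products\<close>

text \<open>The restricted wreath product of \<open>A\<close> by \<open>H\<close>, where \<open>H\<close> acts on \<open>\<Omega>\<close> from the left by \<open>act\<close>.  The element
  \<open>h\<close> sends the base function \<open>f\<close> to \<open>\<lambda>w. f (h\<inverse> w)\<close>.\<close>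

definition wreath_product ::
  "('a, 'm) monoid_scheme \<Rightarrow> 'w set \<Rightarrow> ('h, 'n) monoid_scheme \<Rightarrow> ('h \<Rightarrow> 'w \<Rightarrow> 'w)
    \<Rightarrow> (('w \<Rightarrow> 'a) \<times> 'h) monoid" where
  "wreath_product A \<Omega> H act =
     \<lparr>carrier = {f \<in> \<Omega> \<rightarrow>\<^sub>E carrier A. finite {w \<in> \<Omega>. f w \<noteq> \<one>\<^bsub>A\<^esub>}} \<times> carrier H,
      monoid.mult = (\<lambda>(f, h) (f', h').
        (\<lambda>w\<in>\<Omega>. f w \<otimes>\<^bsub>A\<^esub> f' (act (inv\<^bsub>H\<^esub> h) w), h \<otimes>\<^bsub>H\<^esub> h')),
      one = (\<lambda>w\<in>\<Omega>. \<one>\<^bsub>A\<^esub>, \<one>\<^bsub>H\<^esub>)\<rparr>"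


section \<open>Iterated wreath products of cyclic groups\<close>

text \<open>Points of \<open>(\<int>/n\<int>)\<^sup>k\<close> are lists of length \<open>k\<close>; for \<open>n = 0\<close>, the group \<open>integer_mod_group n\<close> is \<open>\<int>\<close>.\<close>

definition residue_tuples :: "nat \<Rightarrow> nat \<Rightarrow> int list set" where
  "residue_tuples n k = {xs. length xs = k \<and> set xs \<subseteq> carrier (integer_mod_group n)}"

text \<open>A single type for the elements of all the iterated wreath products.  The constructor \<open>Wr\<close> renames
  the pair of a base function and an element of the top group, so that the recursion stays within
  this type.\<close>

datatype welem = Cyc int | Wr "int list \<Rightarrow> int" welem

primrec wact :: "nat \<Rightarrow> welem \<Rightarrow> int list \<Rightarrow> int list" where
  "wact n (Cyc a) xs = [a \<otimes>\<^bsub>integer_mod_group n\<^esub> hd xs]"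
| "wact n (Wr f h) xs =
     (let ys = wact n h (butlast xs) in ys @ [f ys \<otimes>\<^bsub>integer_mod_group n\<^esub> last xs])"

text \<open>\<open>K_grp n k\<close> and \<open>K_gen n k i\<close> are only meant for \<open>1 \<le> k\<close> and \<open>1 \<le> i \<le> k\<close>.\<close>

fun K_grp :: "nat \<Rightarrow> nat \<Rightarrow> welem monoid" where
  "K_grp n (Suc 0) = image_group Cyc (integer_mod_group n)"
| "K_grp n (Suc (Suc k)) = image_group (\<lambda>(f, h). Wr f h)
     (wreath_product (integer_mod_group n) (residue_tuples n (Suc k)) (K_grp n (Suc k)) (wact n))"

text \<open>The generator of \<open>\<int>/n\<int>\<close> is written \<open>1 mod int n\<close>, which is \<open>0\<close> if \<open>n = 1\<close> and \<open>1\<close> otherwise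
  (also for \<open>n = 0\<close>).\<close>

fun K_gen :: "nat \<Rightarrow> nat \<Rightarrow> nat \<Rightarrow> welem" where
  "K_gen n (Suc 0) i = Cyc (1 mod int n)"
| "K_gen n (Suc (Suc k)) i =
     (if i = Suc (Suc k)
      then Wr (\<lambda>xs\<in>residue_tuples n (Suc k). if xs = replicate (Suc k) 0 then 1 mod int n else 0)
              \<one>\<^bsub>K_grp n (Suc k)\<^esub>
      else Wr (\<lambda>xs\<in>residue_tuples n (Suc k). 0) (K_gen n (Suc k) i))"

definition K_hat :: "nat \<Rightarrow> (nat \<Rightarrow> welem) monoid" where
  "K_hat k = subgroup_generated (product_group UNIV (\<lambda>n. K_grp n k)) ((\<lambda>i n. K_gen n k i) ` {1..k})"

end

theory Submission
  imports Defs
begin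

text \<open>A relation of \<open>K_hat k\<close> is a word that acts trivially on \<open>(\<int>/n\<int>)\<^sup>k\<close> for every \<open>n\<close>, since the iterated wreath products
act faithfully on tuples (\<open>K_grp_faithful\<close>).  It is enough to let \<open>n\<close> range over the positive numbers, because
a word changes integer coordinates by a bounded amount and so cannot tell \<open>\<int>\<close> from \<open>\<int>/n\<int>\<close> for large \<open>n\<close>
(\<open>tuple_identity_0\<close>).  The embedding therefore amounts to \<open>k\<close> reversible block maps on a full shift, for
which a word acts trivially if and only if it acts trivially on \<open>(\<int>/n\<int>)\<^sup>k\<close> for all \<open>n \<ge> 1\<close>
(\<open>mon_if_same_relations\<close>, \<open>words_in_K_hat_and_automaton\<close>).

The generator \<open>g\<^sub>j\<close> must find out locally that coordinates \<open>1, \<dots>, j - 1\<close> vanish.  To this end \<open>k\<close> heads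
\<open>0, \<dots>, k - 1\<close> are placed on a cycle of \<open>n\<close> cells, and coordinate \<open>i + 1\<close> is the position of head \<open>i\<close> minus
the position of head \<open>i + 1\<close>, where a head \<open>k\<close> is thought of as pinned at position \<open>0\<close>.  The first \<open>j - 1\<close>
coordinates vanish if and only if the heads \<open>0, \<dots>, j - 1\<close> share a cell, and adding \<open>1\<close> to coordinate \<open>j\<close>
alone means moving this stack of \<open>j\<close> heads one cell forward (\<open>heads_step_coordinates\<close>).  Both are local.

The cycles have to be laid out on the line, in all lengths, and without two heads of the same kind, by means
of local information only.  Every column stores, for each head, whether the head is to its left, in it, or to
its right, that is, the sign of the column minus the head position.  Two adjacent columns are compatible if
their marks can come from one common position; the line is cut at all incompatible pairs, and the pieces,
called belts, then automatically carry at most one head of each kind.  The moves preserve all cuts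
(\<open>ca_step_belt_break\<close>): a column at the end of a belt can only change between two marks that are compatible
with the same marks on the other side.  A parity bit that never changes, and that has to alternate along a belt,
folds the belt into a cycle: heads step two columns to the right from columns of one parity and two columns to
the left from those of the other, turning round at the ends.  All \<open>m\<close> columns of a belt lie on this one cycle, so the
lengths \<open>m\<close> of the cycles take all positive values (\<open>belt_pos_next\<close>).

On a belt that lacks some head, let \<open>r\<close> be the first head that is missing.  Only coordinates \<open>1, \<dots>, r\<close> are
visible, the generators beyond \<open>g\<^sub>r\<close> do nothing, and the heads beyond \<open>r\<close> are never moved; since the first \<open>r\<close>
coordinates of a tuple evolve independently of the later ones, a word that is trivial on tuples is still
trivial on the belt (\<open>simulates_word\<close>, \<open>same_coordinates_imp_same_heads\<close>).  Infinite belts are handled by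
locality: outside of the window that a word can see, the configuration may be replaced by one that is cut
everywhere (\<open>ca_word_identity\<close>).  Conversely, a belt of length \<open>m\<close> with all its heads shows every tuple of
\<open>(\<int>/m\<int>)\<^sup>k\<close> (\<open>tuple_identity_of_ca_word\<close>).  Invertibility of the block maps comes for free, as the words
\<open>g\<^sub>j g\<^sub>j\<inverse>\<close> and \<open>g\<^sub>j\<inverse> g\<^sub>j\<close> are trivial on tuples (\<open>ca_step_cancel\<close>).\<close>

section \<open>Groups with the same relations\<close>

text \<open>A letter \<open>(i, True)\<close> stands for the generator \<open>g i\<close>, and \<open>(i, False)\<close> for its inverse.\<close>

definition word_eval :: "('g, 'm) monoid_scheme \<Rightarrow> ('i \<Rightarrow> 'g) \<Rightarrow> ('i \<times> bool) list \<Rightarrow> 'g" where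
  "word_eval G g w =
     foldr (\<lambda>s z. (if snd s then g (fst s) else inv\<^bsub>G\<^esub> (g (fst s))) \<otimes>\<^bsub>G\<^esub> z) w \<one>\<^bsub>G\<^esub>"

lemma word_eval_Nil [simp]: "word_eval G g [] = \<one>\<^bsub>G\<^esub>"
  by (simp add: word_eval_def)

lemma word_eval_Cons [simp]:
  "word_eval G g (s # w) = (if snd s then g (fst s) else inv\<^bsub>G\<^esub> (g (fst s))) \<otimes>\<^bsub>G\<^esub> word_eval G g w"
  by (simp add: word_eval_def)

definition word_inverse :: "('i \<times> bool) list \<Rightarrow> ('i \<times> bool) list" where
  "word_inverse w = rev (map (\<lambda>s. (fst s, \<not> snd s)) w)"

context group
begin

lemma word_eval_closed:
  assumes "g \<in> I \<rightarrow> carrier G" "set w \<subseteq> I \<times> UNIV"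
  shows "word_eval G g w \<in> carrier G"
  using assms(2) by (induction w) (use assms(1) in \<open>auto simp: Pi_iff\<close>)

lemma word_eval_append:
  assumes "g \<in> I \<rightarrow> carrier G" "set w \<subseteq> I \<times> UNIV" "set w' \<subseteq> I \<times> UNIV"
  shows "word_eval G g (w @ w') = word_eval G g w \<otimes> word_eval G g w'"
  using assms(2)
proof (induction w)
  case Nil
  then show ?case using word_eval_closed[OF assms(1) assms(3)] by simp
next
  case (Cons s w)
  then have "word_eval G g w \<in> carrier G" "g (fst s) \<in> carrier G"
    using word_eval_closed[OF assms(1), of w] assms(1) by auto
  then show ?case using Cons word_eval_closed[OF assms(1) assms(3)] by (auto simp: m_assoc)
qed

lemma word_eval_inverse:
  assumes "g \<in> I \<rightarrow> carrier G" "set w \<subseteq> I \<times> UNIV"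
  shows "word_eval G g (word_inverse w) = inv (word_eval G g w)"
  using assms(2)
proof (induction w)
  case Nil
  then show ?case by (simp add: word_inverse_def)
next
  case (Cons s w)
  have c: "word_eval G g w \<in> carrier G" "g (fst s) \<in> carrier G"
    using word_eval_closed[OF assms(1), of w] assms(1) Cons by auto
  have s: "set (word_inverse w) \<subseteq> I \<times> UNIV" "set [(fst s, \<not> snd s)] \<subseteq> I \<times> UNIV"
    using Cons.prems by (auto simp: word_inverse_def)
  have "word_eval G g (word_inverse (s # w)) = word_eval G g (word_inverse w @ [(fst s, \<not> snd s)])"
    by (simp add: word_inverse_def)
  also have "\<dots> = word_eval G g (word_inverse w) \<otimes> word_eval G g [(fst s, \<not> snd s)]"
    by (rule word_eval_append[OF assms(1) s])
  also have "\<dots> = inv (word_eval G g (s # w))"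
    using Cons c by (simp add: inv_mult_group)
  finally show ?case .
qed

lemma word_eval_eq_iff:
  assumes "g \<in> I \<rightarrow> carrier G" "set w \<subseteq> I \<times> UNIV" "set w' \<subseteq> I \<times> UNIV"
  shows "word_eval G g w = word_eval G g w' \<longleftrightarrow> word_eval G g (w @ word_inverse w') = \<one>"
proof -
  have s: "set (word_inverse w') \<subseteq> I \<times> UNIV" using assms(3) by (auto simp: word_inverse_def)
  have c: "word_eval G g w \<in> carrier G" "word_eval G g w' \<in> carrier G"
    using word_eval_closed[OF assms(1)] assms(2,3) by auto
  have "word_eval G g (w @ word_inverse w') = word_eval G g w \<otimes> inv (word_eval G g w')"
    using word_eval_append[OF assms(1,2) s] word_eval_inverse[OF assms(1,3)] by simp
  then show ?thesis using c by (metis inv_closed inv_equality inv_inv r_inv)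
qed

lemma generate_eq_words:
  assumes "g \<in> I \<rightarrow> carrier G"
  shows "generate G (g ` I) = {word_eval G g w | w. set w \<subseteq> I \<times> UNIV}"
proof (intro equalityI subsetI)
  fix x assume "x \<in> generate G (g ` I)"
  then show "x \<in> {word_eval G g w | w. set w \<subseteq> I \<times> UNIV}"
  proof induction
    case one
    then show ?case by (auto intro!: exI[of _ "[]"])
  next
    case (incl h)
    then obtain i where "i \<in> I" "h = g i" by auto
    then show ?case using assms by (auto simp: Pi_iff intro!: exI[of _ "[(i, True)]"])
  next
    case (inv h)
    then obtain i where "i \<in> I" "h = g i" by auto
    then show ?case using assms by (auto simp: Pi_iff intro!: exI[of _ "[(i, False)]"])
  next
    case (eng h1 h2)
    then obtain w1 w2 where "set w1 \<subseteq> I \<times> UNIV" "h1 = word_eval G g w1" "set w2 \<subseteq> I \<times> UNIV" "h2 = word_eval G g w2"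
      by auto
    then show ?case using word_eval_append[OF assms, of w1 w2] by (auto intro!: exI[of _ "w1 @ w2"])
  qed
next
  fix x assume "x \<in> {word_eval G g w | w. set w \<subseteq> I \<times> UNIV}"
  then obtain w where w: "x = word_eval G g w" "set w \<subseteq> I \<times> UNIV" by auto
  have "word_eval G g w \<in> generate G (g ` I)" using w(2)
    by (induction w) (auto intro!: generate.eng intro: generate.incl generate.inv generate.one)
  then show "x \<in> generate G (g ` I)" using w by simp
qed

end

text \<open>Two words have equal values if and only if one word followed by the inverse of the other is a relation.  Hence
sending the value of a word in \<open>P\<close> to its value in \<open>H\<close> is well defined and injective as soon as the generators
satisfy the same relations.\<close>

lemma mon_if_same_relations:
  assumes P: "group P" and H: "group H"
    and g: "g \<in> I \<rightarrow> carrier P" and h: "h \<in> I \<rightarrow> carrier H"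
    and rel: "\<And>w. set w \<subseteq> I \<times> UNIV \<Longrightarrow> word_eval P g w = \<one>\<^bsub>P\<^esub> \<longleftrightarrow> word_eval H h w = \<one>\<^bsub>H\<^esub>"
  shows "mon (subgroup_generated P (g ` I)) H \<noteq> {}"
proof -
  define word where "word x = (SOME w. set w \<subseteq> I \<times> UNIV \<and> word_eval P g w = x)" for x
  have eq: "word_eval P g w = word_eval P g w' \<longleftrightarrow> word_eval H h w = word_eval H h w'"
    if "set w \<subseteq> I \<times> UNIV" "set w' \<subseteq> I \<times> UNIV" for w w'
    unfolding group.word_eval_eq_iff[OF P g that] group.word_eval_eq_iff[OF H h that]
    by (rule rel) (use that in \<open>auto simp: word_inverse_def\<close>)
  have word: "set (word (word_eval P g w)) \<subseteq> I \<times> UNIV \<and> word_eval P g (word (word_eval P g w)) = word_eval P g w"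
    if "set w \<subseteq> I \<times> UNIV" for w
    unfolding word_def by (rule someI[of _ w]) (use that in auto)
  define \<theta> where "\<theta> x = word_eval H h (word x)" for x
  have \<theta>: "\<theta> (word_eval P g w) = word_eval H h w" if "set w \<subseteq> I \<times> UNIV" for w
    unfolding \<theta>_def using eq[of "word (word_eval P g w)" w] word[OF that] that by simp
  have car: "carrier (subgroup_generated P (g ` I)) = {word_eval P g w | w. set w \<subseteq> I \<times> UNIV}"
  proof -
    have "carrier P \<inter> g ` I = g ` I" using g by auto
    then show ?thesis using group.generate_eq_words[OF P g] by (simp add: carrier_subgroup_generated)
  qed
  have "\<theta> \<in> hom (subgroup_generated P (g ` I)) H"
  proof (rule homI)
    fix x assume "x \<in> carrier (subgroup_generated P (g ` I))"
    then show "\<theta> x \<in> carrier H" using car \<theta> group.word_eval_closed[OF H h] by auto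
  next
    fix x y assume "x \<in> carrier (subgroup_generated P (g ` I))" "y \<in> carrier (subgroup_generated P (g ` I))"
    then obtain w w' where w: "set w \<subseteq> I \<times> UNIV" "x = word_eval P g w" "set w' \<subseteq> I \<times> UNIV" "y = word_eval P g w'"
      using car by auto
    then have "\<theta> (x \<otimes>\<^bsub>P\<^esub> y) = \<theta> (word_eval P g (w @ w'))" using group.word_eval_append[OF P g] by metis
    also have "\<dots> = word_eval H h (w @ w')" using w by (intro \<theta>) auto
    also have "\<dots> = \<theta> x \<otimes>\<^bsub>H\<^esub> \<theta> y" using w \<theta> group.word_eval_append[OF H h] by metis
    finally show "\<theta> (x \<otimes>\<^bsub>subgroup_generated P (g ` I)\<^esub> y) = \<theta> x \<otimes>\<^bsub>H\<^esub> \<theta> y" by simp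
  qed
  moreover have "inj_on \<theta> (carrier (subgroup_generated P (g ` I)))"
    by (rule inj_onI) (use car \<theta> eq in auto)
  ultimately show ?thesis by (auto simp: mon_def)
qed

lemma word_eval_product_group:
  assumes G: "\<And>n. group (G n)" and g: "\<And>i n. i \<in> I \<Longrightarrow> g i n \<in> carrier (G n)" and w: "set w \<subseteq> I \<times> UNIV"
  shows "word_eval (product_group UNIV G) g w = (\<lambda>n. word_eval (G n) (\<lambda>i. g i n) w)"
  using w
proof (induction w)
  case Nil then show ?case by auto
next
  case (Cons s w)
  have "inv\<^bsub>product_group UNIV G\<^esub> g (fst s) = (\<lambda>n. inv\<^bsub>G n\<^esub> g (fst s) n)"
    using Cons.prems g by (subst inv_product_group) (auto simp: G)
  then show ?case using Cons by (auto simp: fun_eq_iff)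
qed

section \<open>Faithful actions of the iterated wreath products\<close>

lemma wreath_product_simps:
  "carrier (wreath_product A \<Omega> H act) = {f \<in> \<Omega> \<rightarrow>\<^sub>E carrier A. finite {w \<in> \<Omega>. f w \<noteq> \<one>\<^bsub>A\<^esub>}} \<times> carrier H"
  "(f, h) \<otimes>\<^bsub>wreath_product A \<Omega> H act\<^esub> (f', h') = (\<lambda>w\<in>\<Omega>. f w \<otimes>\<^bsub>A\<^esub> f' (act (inv\<^bsub>H\<^esub> h) w), h \<otimes>\<^bsub>H\<^esub> h')"
  "\<one>\<^bsub>wreath_product A \<Omega> H act\<^esub> = (\<lambda>w\<in>\<Omega>. \<one>\<^bsub>A\<^esub>, \<one>\<^bsub>H\<^esub>)"
  by (simp_all add: wreath_product_def)

text \<open>Finite supports survive multiplication and inversion because every element of \<open>H\<close> permutes \<open>\<Omega>\<close>, so that the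
translate of a finite support is finite.\<close>

lemma group_wreath_product:
  assumes "group A" "group H"
    and cl: "\<And>h w. h \<in> carrier H \<Longrightarrow> w \<in> \<Omega> \<Longrightarrow> act h w \<in> \<Omega>"
    and one: "\<And>w. w \<in> \<Omega> \<Longrightarrow> act \<one>\<^bsub>H\<^esub> w = w"
    and mult: "\<And>h h' w. h \<in> carrier H \<Longrightarrow> h' \<in> carrier H \<Longrightarrow> w \<in> \<Omega> \<Longrightarrow> act (h \<otimes>\<^bsub>H\<^esub> h') w = act h (act h' w)"
  shows "group (wreath_product A \<Omega> H act)"
proof -
  interpret A: group A by fact
  interpret H: group H by fact
  have inv1: "act h (act (inv\<^bsub>H\<^esub> h) w) = w" "act (inv\<^bsub>H\<^esub> h) (act h w) = w" if "h \<in> carrier H" "w \<in> \<Omega>" for h w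
    using that mult[of h "inv\<^bsub>H\<^esub> h" w] mult[of "inv\<^bsub>H\<^esub> h" h w] one by auto
  have fin: "finite {w \<in> \<Omega>. f (act h w) \<noteq> \<one>\<^bsub>A\<^esub>}" if f: "finite {w \<in> \<Omega>. f w \<noteq> \<one>\<^bsub>A\<^esub>}" and h: "h \<in> carrier H" for f h
  proof (rule finite_subset[OF _ finite_imageI[OF f, of "act (inv\<^bsub>H\<^esub> h)"]])
    show "{w \<in> \<Omega>. f (act h w) \<noteq> \<one>\<^bsub>A\<^esub>} \<subseteq> act (inv\<^bsub>H\<^esub> h) ` {w \<in> \<Omega>. f w \<noteq> \<one>\<^bsub>A\<^esub>}"
    proof
      fix w assume w: "w \<in> {w \<in> \<Omega>. f (act h w) \<noteq> \<one>\<^bsub>A\<^esub>}"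
      then have "act h w \<in> {w \<in> \<Omega>. f w \<noteq> \<one>\<^bsub>A\<^esub>}" "w = act (inv\<^bsub>H\<^esub> h) (act h w)" using cl[OF h] inv1[OF h] by auto
      then show "w \<in> act (inv\<^bsub>H\<^esub> h) ` {w \<in> \<Omega>. f w \<noteq> \<one>\<^bsub>A\<^esub>}" by (rule rev_image_eqI)
    qed
  qed
  let ?W = "wreath_product A \<Omega> H act"
  show ?thesis
  proof (rule groupI)
    fix x y assume "x \<in> carrier ?W" "y \<in> carrier ?W"
    then obtain f h f' h' where x: "x = (f, h)" "f \<in> \<Omega> \<rightarrow>\<^sub>E carrier A" "finite {w \<in> \<Omega>. f w \<noteq> \<one>\<^bsub>A\<^esub>}" "h \<in> carrier H"
      and y: "y = (f', h')" "f' \<in> \<Omega> \<rightarrow>\<^sub>E carrier A" "finite {w \<in> \<Omega>. f' w \<noteq> \<one>\<^bsub>A\<^esub>}" "h' \<in> carrier H"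
      by (auto simp: wreath_product_simps)
    have ih: "inv\<^bsub>H\<^esub> h \<in> carrier H" using x by simp
    have "finite {w \<in> \<Omega>. (\<lambda>w\<in>\<Omega>. f w \<otimes>\<^bsub>A\<^esub> f' (act (inv\<^bsub>H\<^esub> h) w)) w \<noteq> \<one>\<^bsub>A\<^esub>}"
      by (rule finite_subset[OF _ finite_UnI[OF x(3) fin[OF y(3) ih]]]) auto
    then show "x \<otimes>\<^bsub>?W\<^esub> y \<in> carrier ?W" using x y cl[OF ih] by (auto simp: wreath_product_simps)
  next
    show "\<one>\<^bsub>?W\<^esub> \<in> carrier ?W" by (simp add: wreath_product_simps)
  next
    fix x y z assume "x \<in> carrier ?W" "y \<in> carrier ?W" "z \<in> carrier ?W"
    then obtain f h f' h' f'' h'' where x: "x = (f, h)" "f \<in> \<Omega> \<rightarrow>\<^sub>E carrier A" "h \<in> carrier H"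
      and y: "y = (f', h')" "f' \<in> \<Omega> \<rightarrow>\<^sub>E carrier A" "h' \<in> carrier H"
      and z: "z = (f'', h'')" "f'' \<in> \<Omega> \<rightarrow>\<^sub>E carrier A" "h'' \<in> carrier H"
      by (auto simp: wreath_product_simps)
    have i: "inv\<^bsub>H\<^esub> h \<in> carrier H" "inv\<^bsub>H\<^esub> h' \<in> carrier H" using x y by simp_all
    have c: "f w \<in> carrier A" "f' w \<in> carrier A" "f'' w \<in> carrier A" if "w \<in> \<Omega>" for w using x y z that by auto
    have a: "act (inv\<^bsub>H\<^esub> (h \<otimes>\<^bsub>H\<^esub> h')) w = act (inv\<^bsub>H\<^esub> h') (act (inv\<^bsub>H\<^esub> h) w)" if "w \<in> \<Omega>" for w
      using mult[OF i(2,1) that] x y by (simp add: H.inv_mult_group)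
    show "x \<otimes>\<^bsub>?W\<^esub> y \<otimes>\<^bsub>?W\<^esub> z = x \<otimes>\<^bsub>?W\<^esub> (y \<otimes>\<^bsub>?W\<^esub> z)"
      using x y z c cl[OF i(1)] cl[OF i(2)] by (auto simp: wreath_product_simps a A.m_assoc H.m_assoc fun_eq_iff)
  next
    fix x assume "x \<in> carrier ?W"
    then obtain f h where x: "x = (f, h)" "f \<in> \<Omega> \<rightarrow>\<^sub>E carrier A" "h \<in> carrier H"
      by (auto simp: wreath_product_simps)
    then show "\<one>\<^bsub>?W\<^esub> \<otimes>\<^bsub>?W\<^esub> x = x"
      by (auto simp: wreath_product_simps fun_eq_iff one PiE_iff extensional_def)
  next
    fix x assume "x \<in> carrier ?W"
    then obtain f h where x: "x = (f, h)" "f \<in> \<Omega> \<rightarrow>\<^sub>E carrier A" "finite {w \<in> \<Omega>. f w \<noteq> \<one>\<^bsub>A\<^esub>}" "h \<in> carrier H"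
      by (auto simp: wreath_product_simps)
    define g where "g = (\<lambda>w\<in>\<Omega>. inv\<^bsub>A\<^esub> (f (act h w)))"
    have fc: "f (act h w) \<in> carrier A" if "w \<in> \<Omega>" for w using x cl[OF x(4) that] by auto
    have "{w \<in> \<Omega>. g w \<noteq> \<one>\<^bsub>A\<^esub>} \<subseteq> {w \<in> \<Omega>. f (act h w) \<noteq> \<one>\<^bsub>A\<^esub>}" by (auto simp: g_def)
    then have "finite {w \<in> \<Omega>. g w \<noteq> \<one>\<^bsub>A\<^esub>}" using fin[OF x(3,4)] finite_subset by blast
    then have "(g, inv\<^bsub>H\<^esub> h) \<in> carrier ?W" using x fc by (auto simp: wreath_product_simps g_def)
    moreover have "(g, inv\<^bsub>H\<^esub> h) \<otimes>\<^bsub>?W\<^esub> x = \<one>\<^bsub>?W\<^esub>"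
      using x fc by (auto simp: wreath_product_simps g_def fun_eq_iff)
    ultimately show "\<exists>y\<in>carrier ?W. y \<otimes>\<^bsub>?W\<^esub> x = \<one>\<^bsub>?W\<^esub>" by blast
  qed
qed

lemma image_group_mult:
  assumes "inj_on f (carrier G)" "a \<in> carrier G" "b \<in> carrier G"
  shows "f a \<otimes>\<^bsub>image_group f G\<^esub> f b = f (a \<otimes>\<^bsub>G\<^esub> b)"
  using assms by (simp add: image_group_def)

lemma group_image_group:
  assumes "group G" "inj_on f (carrier G)"
  shows "group (image_group f G)"
  using group.iso_imp_img_group[OF assms(1) inj_imp_image_group_iso[OF assms(2)]]
  by (simp add: image_group_def)

text \<open>Stated for functions that are arbitrary outside of \<open>\<Omega>\<close>, since \<open>wact n g\<close> is not extensional.\<close>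

definition acts_faithfully :: "('g, 'm) monoid_scheme \<Rightarrow> ('g \<Rightarrow> 'w \<Rightarrow> 'w) \<Rightarrow> 'w set \<Rightarrow> bool" where
  "acts_faithfully G act \<Omega> \<longleftrightarrow>
     (\<forall>g\<in>carrier G. \<forall>w\<in>\<Omega>. act g w \<in> \<Omega>) \<and>
     (\<forall>w\<in>\<Omega>. act \<one>\<^bsub>G\<^esub> w = w) \<and>
     (\<forall>g\<in>carrier G. \<forall>h\<in>carrier G. \<forall>w\<in>\<Omega>. act (g \<otimes>\<^bsub>G\<^esub> h) w = act g (act h w)) \<and>
     (\<forall>g\<in>carrier G. (\<forall>w\<in>\<Omega>. act g w = w) \<longrightarrow> g = \<one>\<^bsub>G\<^esub>)"

lemma residue_tuples_snoc:
  "xs \<in> residue_tuples n (Suc k) \<longleftrightarrow>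
     (\<exists>ys a. xs = ys @ [a] \<and> ys \<in> residue_tuples n k \<and> a \<in> carrier (integer_mod_group n))"
  by (cases xs rule: rev_cases) (auto simp: residue_tuples_def)

lemma mod_in_integer_mod_group [simp]: "z mod int n \<in> carrier (integer_mod_group n)"
  by (simp add: carrier_integer_mod_group)

lemma integer_mod_group_mod: "a \<in> carrier (integer_mod_group n) \<Longrightarrow> a mod int n = a"
  by (auto simp: carrier_integer_mod_group split: if_splits)

lemma K_grp_1:
  "carrier (K_grp n (Suc 0)) = Cyc ` carrier (integer_mod_group n)"
  "\<one>\<^bsub>K_grp n (Suc 0)\<^esub> = Cyc 0"
  "a \<in> carrier (integer_mod_group n) \<Longrightarrow> b \<in> carrier (integer_mod_group n) \<Longrightarrow>
     Cyc a \<otimes>\<^bsub>K_grp n (Suc 0)\<^esub> Cyc b = Cyc ((a + b) mod int n)"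
  using image_group_mult[of Cyc "integer_mod_group n" a b]
  by (simp_all add: image_group_carrier image_group_one inj_on_def)

lemma K_grp_1_faithful:
  "group (K_grp n (Suc 0))" "acts_faithfully (K_grp n (Suc 0)) (wact n) (residue_tuples n (Suc 0))"
proof -
  show "group (K_grp n (Suc 0))"
    by (simp add: group_image_group inj_on_def)
  have ex: "\<exists>a. w = [a] \<and> a \<in> carrier (integer_mod_group n)" if "w \<in> residue_tuples n (Suc 0)" for w
    using that by (auto simp: residue_tuples_def length_Suc_conv)
  have z: "[0] \<in> residue_tuples n (Suc 0)" by (simp add: residue_tuples_def)
  show "acts_faithfully (K_grp n (Suc 0)) (wact n) (residue_tuples n (Suc 0))"
    unfolding acts_faithfully_def
  proof (intro conjI ballI impI)
    fix g w assume "g \<in> carrier (K_grp n (Suc 0))" "w \<in> residue_tuples n (Suc 0)"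
    then show "wact n g w \<in> residue_tuples n (Suc 0)" by (auto simp: K_grp_1(1) residue_tuples_def simp del: K_grp.simps)
  next
    fix w assume "w \<in> residue_tuples n (Suc 0)"
    then show "wact n \<one>\<^bsub>K_grp n (Suc 0)\<^esub> w = w"
      using ex[of w] by (auto simp: K_grp_1(2) integer_mod_group_mod simp del: K_grp.simps)
  next
    fix g h w assume "g \<in> carrier (K_grp n (Suc 0))" "h \<in> carrier (K_grp n (Suc 0))" "w \<in> residue_tuples n (Suc 0)"
    then show "wact n (g \<otimes>\<^bsub>K_grp n (Suc 0)\<^esub> h) w = wact n g (wact n h w)"
      by (auto simp: K_grp_1 mod_simps add.assoc simp del: K_grp.simps)
  next
    fix g assume "g \<in> carrier (K_grp n (Suc 0))" "\<forall>w\<in>residue_tuples n (Suc 0). wact n g w = w"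
    then show "g = \<one>\<^bsub>K_grp n (Suc 0)\<^esub>"
      using z by (auto simp: K_grp_1 integer_mod_group_mod simp del: K_grp.simps)
  qed
qed

lemma inj_on_Wr: "inj_on (\<lambda>(f, h). Wr f h) S"
  by (auto simp: inj_on_def)

context
  fixes n k :: nat
  assumes grp: "group (K_grp n (Suc k))"
    and act: "acts_faithfully (K_grp n (Suc k)) (wact n) (residue_tuples n (Suc k))"
begin

lemma top_act:
  "h \<in> carrier (K_grp n (Suc k)) \<Longrightarrow> w \<in> residue_tuples n (Suc k) \<Longrightarrow> wact n h w \<in> residue_tuples n (Suc k)"
  "w \<in> residue_tuples n (Suc k) \<Longrightarrow> wact n \<one>\<^bsub>K_grp n (Suc k)\<^esub> w = w"
  "h \<in> carrier (K_grp n (Suc k)) \<Longrightarrow> h' \<in> carrier (K_grp n (Suc k)) \<Longrightarrow> w \<in> residue_tuples n (Suc k) \<Longrightarrow>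
     wact n (h \<otimes>\<^bsub>K_grp n (Suc k)\<^esub> h') w = wact n h (wact n h' w)"
  "h \<in> carrier (K_grp n (Suc k)) \<Longrightarrow> (\<And>w. w \<in> residue_tuples n (Suc k) \<Longrightarrow> wact n h w = w) \<Longrightarrow> h = \<one>\<^bsub>K_grp n (Suc k)\<^esub>"
  using act by (auto simp: acts_faithfully_def)

lemma group_wreath_step:
  "group (wreath_product (integer_mod_group n) (residue_tuples n (Suc k)) (K_grp n (Suc k)) (wact n))"
  by (rule group_wreath_product[OF group_integer_mod_group grp]) (use top_act in auto)

lemma K_grp_step_group: "group (K_grp n (Suc (Suc k)))"
  using group_image_group[OF group_wreath_step inj_on_Wr] by simp

lemma K_grp_step_carrier:
  "g \<in> carrier (K_grp n (Suc (Suc k))) \<longleftrightarrow>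
     (\<exists>f h. g = Wr f h \<and> f \<in> residue_tuples n (Suc k) \<rightarrow>\<^sub>E carrier (integer_mod_group n) \<and>
        finite {w \<in> residue_tuples n (Suc k). f w \<noteq> 0} \<and> h \<in> carrier (K_grp n (Suc k)))"
  by (auto simp: image_group_carrier wreath_product_simps image_iff)

lemma K_grp_step_one:
  "\<one>\<^bsub>K_grp n (Suc (Suc k))\<^esub> = Wr (\<lambda>w\<in>residue_tuples n (Suc k). 0) \<one>\<^bsub>K_grp n (Suc k)\<^esub>"
  by (simp add: image_group_one wreath_product_simps)

lemma K_grp_step_mult:
  assumes "Wr f h \<in> carrier (K_grp n (Suc (Suc k)))" "Wr f' h' \<in> carrier (K_grp n (Suc (Suc k)))"
  shows "Wr f h \<otimes>\<^bsub>K_grp n (Suc (Suc k))\<^esub> Wr f' h' =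
    Wr (\<lambda>w\<in>residue_tuples n (Suc k). (f w + f' (wact n (inv\<^bsub>K_grp n (Suc k)\<^esub> h) w)) mod int n)
       (h \<otimes>\<^bsub>K_grp n (Suc k)\<^esub> h')"
proof -
  let ?W = "wreath_product (integer_mod_group n) (residue_tuples n (Suc k)) (K_grp n (Suc k)) (wact n)"
  have "(f, h) \<in> carrier ?W" "(f', h') \<in> carrier ?W"
    using assms by (auto simp: K_grp_step_carrier wreath_product_simps simp del: K_grp.simps)
  from image_group_mult[OF inj_on_Wr this]
  show ?thesis by (simp add: wreath_product_simps)
qed

text \<open>An element \<open>(f, h)\<close> sends a tuple with initial part \<open>ys\<close> and last entry \<open>0\<close> to one with initial part \<open>h ys\<close> and
last entry \<open>f (h ys)\<close>.  If it fixes all these tuples, then \<open>h\<close> acts trivially, and hence \<open>f = 0\<close>.\<close>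

lemma K_grp_step_faithful:
  "acts_faithfully (K_grp n (Suc (Suc k))) (wact n) (residue_tuples n (Suc (Suc k)))"
  unfolding acts_faithfully_def
proof (intro conjI ballI impI)
  interpret H: group "K_grp n (Suc k)" by (rule grp)
  fix g w assume "g \<in> carrier (K_grp n (Suc (Suc k)))" "w \<in> residue_tuples n (Suc (Suc k))"
  then obtain f h ys a where "g = Wr f h" "h \<in> carrier (K_grp n (Suc k))" "w = ys @ [a]" "ys \<in> residue_tuples n (Suc k)"
    by (auto simp: K_grp_step_carrier residue_tuples_snoc[of _ _ "Suc k"] simp del: K_grp.simps)
  then show "wact n g w \<in> residue_tuples n (Suc (Suc k))"
    using top_act(1) by (simp add: residue_tuples_snoc[of _ _ "Suc k"] Let_def)
next
  fix w assume "w \<in> residue_tuples n (Suc (Suc k))"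
  then obtain ys a where "w = ys @ [a]" "ys \<in> residue_tuples n (Suc k)" "a \<in> carrier (integer_mod_group n)"
    by (auto simp: residue_tuples_snoc[of _ _ "Suc k"])
  then show "wact n \<one>\<^bsub>K_grp n (Suc (Suc k))\<^esub> w = w"
    unfolding K_grp_step_one using top_act(2) by (simp add: Let_def integer_mod_group_mod)
next
  interpret H: group "K_grp n (Suc k)" by (rule grp)
  fix g g' w assume g: "g \<in> carrier (K_grp n (Suc (Suc k)))" "g' \<in> carrier (K_grp n (Suc (Suc k)))"
    and "w \<in> residue_tuples n (Suc (Suc k))"
  then obtain f h f' h' ys a where gs: "g = Wr f h" "h \<in> carrier (K_grp n (Suc k))"
      "g' = Wr f' h'" "h' \<in> carrier (K_grp n (Suc k))"
    and w: "w = ys @ [a]" "ys \<in> residue_tuples n (Suc k)"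
    by (auto simp: K_grp_step_carrier residue_tuples_snoc[of _ _ "Suc k"] simp del: K_grp.simps)
  define zs where "zs = wact n h' ys"
  have zs: "zs \<in> residue_tuples n (Suc k)" "wact n h zs \<in> residue_tuples n (Suc k)"
    using top_act(1) gs w by (simp_all add: zs_def)
  have i: "wact n (inv\<^bsub>K_grp n (Suc k)\<^esub> h) (wact n h zs) = zs"
    using top_act(2)[OF zs(1)] top_act(3)[OF _ gs(2) zs(1), of "inv\<^bsub>K_grp n (Suc k)\<^esub> h"] gs(2) by simp
  have m: "wact n (h \<otimes>\<^bsub>K_grp n (Suc k)\<^esub> h') ys = wact n h zs"
    using top_act(3)[OF gs(2,4) w(2)] by (simp add: zs_def)
  show "wact n (g \<otimes>\<^bsub>K_grp n (Suc (Suc k))\<^esub> g') w = wact n g (wact n g' w)"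
    using K_grp_step_mult[of f h f' h'] g zs i m
    unfolding gs w by (simp add: Let_def zs_def[symmetric] mod_simps add.assoc del: K_grp.simps)
next
  fix g assume g: "g \<in> carrier (K_grp n (Suc (Suc k)))" and id: "\<forall>w\<in>residue_tuples n (Suc (Suc k)). wact n g w = w"
  then obtain f h where gf: "g = Wr f h" "f \<in> residue_tuples n (Suc k) \<rightarrow>\<^sub>E carrier (integer_mod_group n)"
     "h \<in> carrier (K_grp n (Suc k))"
    by (auto simp: K_grp_step_carrier simp del: K_grp.simps)
  have w: "wact n h ys = ys \<and> f ys = 0" if ys: "ys \<in> residue_tuples n (Suc k)" for ys
  proof -
    have "ys @ [0] \<in> residue_tuples n (Suc (Suc k))" using ys by (simp add: residue_tuples_snoc[of _ _ "Suc k"])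
    then have "wact n g (ys @ [0]) = ys @ [0]" using id by blast
    then have "wact n h ys = ys \<and> f ys mod int n = 0" by (auto simp: gf(1) Let_def)
    moreover have "f ys \<in> carrier (integer_mod_group n)" using gf(2) ys by auto
    ultimately show ?thesis by (simp add: integer_mod_group_mod)
  qed
  have "h = \<one>\<^bsub>K_grp n (Suc k)\<^esub>" using top_act(4)[OF gf(3)] w by blast
  moreover have "f = (\<lambda>w\<in>residue_tuples n (Suc k). 0)"
    using gf(2) w by (auto simp: fun_eq_iff PiE_iff extensional_def)
  ultimately show "g = \<one>\<^bsub>K_grp n (Suc (Suc k))\<^esub>" unfolding K_grp_step_one gf(1) by simp
qed

end

lemma K_grp_faithful:
  "group (K_grp n (Suc k)) \<and> acts_faithfully (K_grp n (Suc k)) (wact n) (residue_tuples n (Suc k))"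
proof (induction k)
  case 0 then show ?case using K_grp_1_faithful by blast
next
  case (Suc k)
  then show ?case using K_grp_step_group K_grp_step_faithful by blast
qed

section \<open>The generators as steps on tuples\<close>

text \<open>The generators in explicit form: \<open>(j, True)\<close> and \<open>(j, False)\<close> add \<open>1\<close> and \<open>-1\<close> to the \<open>j\<close>-th coordinate, which is
entry \<open>j - 1\<close> of the list.  As \<open>z mod 0 = z\<close>, the case \<open>n = 0\<close> is the action on \<open>\<int>\<^sup>k\<close>.\<close>

definition tuple_step :: "nat \<Rightarrow> nat \<times> bool \<Rightarrow> int list \<Rightarrow> int list" where
  "tuple_step n s v =
     (if \<forall>i < fst s - 1. v ! i = 0
      then v[fst s - 1 := (v ! (fst s - 1) + (if snd s then 1 else - 1)) mod int n] else v)"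

lemma length_tuple_step [simp]: "length (tuple_step n s v) = length v"
  by (simp add: tuple_step_def)

definition letters :: "nat \<Rightarrow> (nat \<times> bool) set" where
  "letters k = {1..k} \<times> UNIV"

definition tuple_identity :: "nat \<Rightarrow> nat \<Rightarrow> (nat \<times> bool) list \<Rightarrow> bool" where
  "tuple_identity k m w \<longleftrightarrow> (\<forall>v. length v = k \<and> (m \<noteq> 0 \<longrightarrow> set v \<subseteq> {0..<int m}) \<longrightarrow> foldr (tuple_step m) w v = v)"

lemma tuple_step_snoc:
  assumes "1 \<le> fst s" "fst s \<le> length ys"
  shows "tuple_step n s (ys @ [a]) = tuple_step n s ys @ [a]"
  using assms by (auto simp: tuple_step_def nth_append list_update_append)

text \<open>The last generator lives in the base of the wreath product and changes the last entry; the earlier ones come from the top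
group and act on the initial part of the tuple.\<close>

lemma K_gen_act:
  assumes "1 \<le> i" "i \<le> Suc k"
  shows "K_gen n (Suc k) i \<in> carrier (K_grp n (Suc k)) \<and>
    (\<forall>v\<in>residue_tuples n (Suc k). wact n (K_gen n (Suc k) i) v = tuple_step n (i, True) v)"
  using assms(2)
proof (induction k)
  case 0
  then have "i = 1" using assms by simp
  then show ?case
    by (auto simp: K_grp_1(1) residue_tuples_def length_Suc_conv tuple_step_def mod_simps add.commute simp del: K_grp.simps)
next
  case (Suc k)
  have grp: "group (K_grp n (Suc k))" and act: "acts_faithfully (K_grp n (Suc k)) (wact n) (residue_tuples n (Suc k))"
    using K_grp_faithful by blast+
  interpret H: group "K_grp n (Suc k)" by (rule grp)
  note car = K_grp_step_carrier[OF grp act]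
  show ?case
  proof (cases "i = Suc (Suc k)")
    case True
    let ?\<delta> = "\<lambda>xs\<in>residue_tuples n (Suc k). if xs = replicate (Suc k) 0 then 1 mod int n else 0"
    have g: "K_gen n (Suc (Suc k)) i = Wr ?\<delta> \<one>\<^bsub>K_grp n (Suc k)\<^esub>" using True by simp
    have "finite {w \<in> residue_tuples n (Suc k). ?\<delta> w \<noteq> 0}"
      by (rule finite_subset[of _ "{replicate (Suc k) 0}"]) auto
    then have "Wr ?\<delta> \<one>\<^bsub>K_grp n (Suc k)\<^esub> \<in> carrier (K_grp n (Suc (Suc k)))"
      unfolding car by (auto simp del: K_grp.simps replicate.simps)
    moreover have "wact n (Wr ?\<delta> \<one>\<^bsub>K_grp n (Suc k)\<^esub>) v = tuple_step n (i, True) v"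
      if v: "v \<in> residue_tuples n (Suc (Suc k))" for v
    proof -
      obtain ys a where v: "v = ys @ [a]" "ys \<in> residue_tuples n (Suc k)" "a \<in> carrier (integer_mod_group n)"
        using v by (auto simp: residue_tuples_snoc[of _ _ "Suc k"])
      have len: "length ys = Suc k" using v(2) by (simp add: residue_tuples_def)
      have "(\<forall>l<Suc k. v ! l = 0) \<longleftrightarrow> ys = replicate (Suc k) 0"
        using len by (auto simp: v nth_append list_eq_iff_nth_eq simp del: replicate.simps)
      then have "tuple_step n (i, True) v = (if ys = replicate (Suc k) 0 then ys @ [(a + 1) mod int n] else v)"
        using True len by (simp add: tuple_step_def v nth_append list_update_append del: replicate.simps)
      moreover have "wact n (Wr ?\<delta> \<one>\<^bsub>K_grp n (Suc k)\<^esub>) v =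
          (if ys = replicate (Suc k) 0 then ys @ [(a + 1) mod int n] else v)"
        using v top_act(2)[OF grp act v(2)]
        by (simp add: Let_def integer_mod_group_mod mod_simps add.commute del: K_grp.simps replicate.simps)
      ultimately show ?thesis by simp
    qed
    ultimately show ?thesis unfolding g by blast
  next
    case False
    then have i: "i \<le> Suc k" using Suc.prems by simp
    have g: "K_gen n (Suc (Suc k)) i = Wr (\<lambda>xs\<in>residue_tuples n (Suc k). 0) (K_gen n (Suc k) i)" using False by simp
    have IH: "K_gen n (Suc k) i \<in> carrier (K_grp n (Suc k))"
      "\<And>v. v \<in> residue_tuples n (Suc k) \<Longrightarrow> wact n (K_gen n (Suc k) i) v = tuple_step n (i, True) v"
      using Suc.IH[OF i] by blast+
    have "Wr (\<lambda>xs\<in>residue_tuples n (Suc k). 0) (K_gen n (Suc k) i) \<in> carrier (K_grp n (Suc (Suc k)))"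
      unfolding car using IH(1) by (auto simp del: K_grp.simps K_gen.simps)
    moreover have "wact n (Wr (\<lambda>xs\<in>residue_tuples n (Suc k). 0) (K_gen n (Suc k) i)) v = tuple_step n (i, True) v"
      if v: "v \<in> residue_tuples n (Suc (Suc k))" for v
    proof -
      obtain ys a where v: "v = ys @ [a]" "ys \<in> residue_tuples n (Suc k)" "a \<in> carrier (integer_mod_group n)"
        using v by (auto simp: residue_tuples_snoc[of _ _ "Suc k"])
      have "length ys = Suc k" using v(2) by (simp add: residue_tuples_def)
      then have "tuple_step n (i, True) v = tuple_step n (i, True) ys @ [a]"
        using tuple_step_snoc[of "(i, True)" ys n a] assms(1) i by (simp add: v)
      moreover have "tuple_step n (i, True) ys \<in> residue_tuples n (Suc k)"
        using top_act(1)[OF grp act IH(1) v(2)] IH(2)[OF v(2)] by simp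
      ultimately show ?thesis using v IH(2)[OF v(2)]
        by (simp add: Let_def integer_mod_group_mod del: K_grp.simps K_gen.simps)
    qed
    ultimately show ?thesis unfolding g by blast
  qed
qed

lemma residue_tuples_nth:
  "v \<in> residue_tuples n k \<Longrightarrow> i < k \<Longrightarrow> v ! i mod int n = v ! i"
  by (rule integer_mod_group_mod) (auto simp: residue_tuples_def)

lemma tuple_step_closed:
  "v \<in> residue_tuples n k \<Longrightarrow> tuple_step n s v \<in> residue_tuples n k"
  by (auto simp: residue_tuples_def tuple_step_def dest!: set_update_subset_insert[THEN subsetD])

lemma tuple_step_cancel:
  assumes "v \<in> residue_tuples n k" "1 \<le> i" "i \<le> k"
  shows "tuple_step n (i, b) (tuple_step n (i, \<not> b) v) = v"
proof -
  have "i - 1 < length v" "v ! (i - 1) mod int n = v ! (i - 1)"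
    using assms residue_tuples_nth by (auto simp: residue_tuples_def)
  then show ?thesis by (auto simp: tuple_step_def mod_simps)
qed

lemma wact_word_eval:
  assumes w: "set w \<subseteq> letters (Suc k)" and v: "v \<in> residue_tuples n (Suc k)"
  shows "wact n (word_eval (K_grp n (Suc k)) (K_gen n (Suc k)) w) v = foldr (tuple_step n) w v \<and>
    foldr (tuple_step n) w v \<in> residue_tuples n (Suc k)"
  using w
proof (induction w)
  interpret G: group "K_grp n (Suc k)" using K_grp_faithful by blast
  have grp: "group (K_grp n (Suc k))" and act: "acts_faithfully (K_grp n (Suc k)) (wact n) (residue_tuples n (Suc k))"
    using K_grp_faithful by blast+
  note act = top_act[OF grp act]
  {
    case Nil
    then show ?case using v act(2) by simp
  next
    case (Cons s w)
    define u where "u = foldr (tuple_step n) w v"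
    have u: "wact n (word_eval (K_grp n (Suc k)) (K_gen n (Suc k)) w) v = u" "u \<in> residue_tuples n (Suc k)"
      using Cons by (simp_all add: u_def)
    obtain i b where s: "s = (i, b)" "1 \<le> i" "i \<le> Suc k" using Cons.prems by (auto simp: letters_def)
    let ?g = "K_gen n (Suc k) i"
    have g: "?g \<in> carrier (K_grp n (Suc k))"
      "\<And>v. v \<in> residue_tuples n (Suc k) \<Longrightarrow> wact n ?g v = tuple_step n (i, True) v"
      using K_gen_act[OF s(2,3)] by blast+
    have ev: "word_eval (K_grp n (Suc k)) (K_gen n (Suc k)) w \<in> carrier (K_grp n (Suc k))"
      using G.word_eval_closed[of "K_gen n (Suc k)" "{1..Suc k}" w] K_gen_act Cons.prems
      by (auto simp: letters_def)
    have inv: "wact n (inv\<^bsub>K_grp n (Suc k)\<^esub> ?g) u = tuple_step n (i, False) u"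
    proof -
      define u' where "u' = tuple_step n (i, False) u"
      have u': "u' \<in> residue_tuples n (Suc k)" using u(2) tuple_step_closed by (simp add: u'_def)
      have "wact n ?g u' = u" using g(2)[OF u'] tuple_step_cancel[OF u(2) s(2,3), of True] by (simp add: u'_def)
      then have "wact n (inv\<^bsub>K_grp n (Suc k)\<^esub> ?g) u = wact n (inv\<^bsub>K_grp n (Suc k)\<^esub> ?g \<otimes>\<^bsub>K_grp n (Suc k)\<^esub> ?g) u'"
        using act(3)[OF G.inv_closed[OF g(1)] g(1) u'] by simp
      also have "\<dots> = u'" using G.l_inv[OF g(1)] act(2)[OF u'] by simp
      finally show ?thesis by (simp add: u'_def)
    qed
    have "wact n (word_eval (K_grp n (Suc k)) (K_gen n (Suc k)) (s # w)) v = tuple_step n s u"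
      using act(3)[OF g(1) ev v] act(3)[OF G.inv_closed[OF g(1)] ev v] g(2)[OF u(2)] inv u(1)
      by (cases b) (simp_all add: s(1))
    then show ?case using tuple_step_closed[OF u(2)] by (simp add: u_def)
  }
qed

lemma word_eval_K_grp_eq_one:
  assumes w: "set w \<subseteq> letters (Suc k)"
  shows "word_eval (K_grp n (Suc k)) (K_gen n (Suc k)) w = \<one>\<^bsub>K_grp n (Suc k)\<^esub> \<longleftrightarrow> tuple_identity (Suc k) n w"
proof -
  interpret G: group "K_grp n (Suc k)" using K_grp_faithful by blast
  have grp: "group (K_grp n (Suc k))" and act: "acts_faithfully (K_grp n (Suc k)) (wact n) (residue_tuples n (Suc k))"
    using K_grp_faithful by blast+
  note act = top_act[OF grp act]
  have ev: "word_eval (K_grp n (Suc k)) (K_gen n (Suc k)) w \<in> carrier (K_grp n (Suc k))"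
    using G.word_eval_closed[of "K_gen n (Suc k)" "{1..Suc k}" w] K_gen_act w by (auto simp: letters_def)
  have "tuple_identity (Suc k) n w \<longleftrightarrow> (\<forall>v\<in>residue_tuples n (Suc k). foldr (tuple_step n) w v = v)"
    by (auto simp: tuple_identity_def residue_tuples_def carrier_integer_mod_group)
  also have "\<dots> \<longleftrightarrow> (\<forall>v\<in>residue_tuples n (Suc k). wact n (word_eval (K_grp n (Suc k)) (K_gen n (Suc k)) w) v = v)"
    using wact_word_eval[OF w] by auto
  also have "\<dots> \<longleftrightarrow> word_eval (K_grp n (Suc k)) (K_gen n (Suc k)) w = \<one>\<^bsub>K_grp n (Suc k)\<^esub>"
    using act(2) act(4)[OF ev] by auto
  finally show ?thesis by simp
qed

lemma small_mod_eq_0: "\<bar>z\<bar> < m \<Longrightarrow> z mod m = 0 \<longleftrightarrow> z = 0" for z m :: int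
  by (metis abs_of_nonneg dvd_imp_le_int mod_0 mod_0_imp_dvd abs_zero less_le_not_le order.strict_trans1 abs_of_pos abs_ge_zero)

text \<open>Reduction modulo \<open>m\<close> commutes with the generators only where it does not create new zeros.  This is the case as long
as all coordinates have absolute value below \<open>m\<close>, and a word of length \<open>l\<close> raises a bound on them by at most \<open>l\<close>.\<close>

lemma tuple_word_reduction:
  assumes "\<forall>i<length v. \<bar>v ! i\<bar> \<le> B" "B + int (length w) < int m" "set w \<subseteq> letters (length v)"
  shows "map (\<lambda>z. z mod int m) (foldr (tuple_step 0) w v) = foldr (tuple_step m) w (map (\<lambda>z. z mod int m) v) \<and>
    length (foldr (tuple_step 0) w v) = length v \<and>
    (\<forall>i<length v. \<bar>foldr (tuple_step 0) w v ! i\<bar> \<le> B + int (length w))"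
  using assms(2,3)
proof (induction w)
  case Nil then show ?case using assms(1) by simp
next
  case (Cons s w)
  define u where "u = foldr (tuple_step 0) w v"
  have IH: "map (\<lambda>z. z mod int m) u = foldr (tuple_step m) w (map (\<lambda>z. z mod int m) v)"
    "length u = length v" "\<And>i. i < length v \<Longrightarrow> \<bar>u ! i\<bar> \<le> B + int (length w)"
    using Cons by (auto simp: u_def)
  have s: "1 \<le> fst s" "fst s \<le> length v" using Cons.prems by (auto simp: letters_def)
  have z: "(map (\<lambda>z. z mod int m) u ! i = 0) = (u ! i = 0)" if "i < fst s - 1" for i
  proof -
    have i: "i < length v" using that s by simp
    have "\<bar>u ! i\<bar> < int m" using IH(3)[OF i] Cons.prems(1) by simp
    then show ?thesis using i IH(2) small_mod_eq_0[of "u ! i" "int m"] by simp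
  qed
  have "map (\<lambda>z. z mod int m) (tuple_step 0 s u) = tuple_step m s (map (\<lambda>z. z mod int m) u)"
    using z s IH(2) by (auto simp: tuple_step_def map_update mod_simps)
  moreover have "\<bar>tuple_step 0 s u ! i\<bar> \<le> B + int (length (s # w))" if "i < length v" for i
    using IH(3)[OF that] IH(3)[of "fst s - 1"] IH(2) s that
    by (auto simp: tuple_step_def nth_list_update)
  ultimately show ?case using IH by (simp add: u_def)
qed

text \<open>The tuple and its image under the word agree modulo every \<open>m\<close> that is large enough for reduction to commute with the
word.  If \<open>m\<close> also exceeds the distance between their entries, they are equal.\<close>

lemma tuple_identity_0:
  assumes w: "set w \<subseteq> letters k" and T: "\<And>m. 1 \<le> m \<Longrightarrow> tuple_identity k m w"
  shows "tuple_identity k 0 w"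
  unfolding tuple_identity_def
proof (intro allI impI, elim conjE)
  fix v :: "int list"
  assume len: "length v = k"
  define B where "B = (\<Sum>z\<leftarrow>v. \<bar>z\<bar>)"
  have vB: "\<bar>v ! i\<bar> \<le> B" if "i < length v" for i
  proof -
    have "\<bar>v ! i\<bar> \<in> set (map abs v)" using nth_mem[OF that] by (simp del: nth_mem)
    then show ?thesis unfolding B_def by (rule member_le_sum_list) auto
  qed
  have B0: "0 \<le> B" unfolding B_def by (rule sum_list_nonneg) auto
  \<comment> \<open>the tuple is bounded by \<open>B\<close> and its image by \<open>B + length w\<close>, so they differ by less than this \<open>m\<close>\<close>
  define m where "m = nat (2 * B + int (length w) + 1)"
  have m: "int m = 2 * B + int (length w) + 1" using B0 by (simp add: m_def)
  have red: "map (\<lambda>z. z mod int m) (foldr (tuple_step 0) w v) = foldr (tuple_step m) w (map (\<lambda>z. z mod int m) v)"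
    "length (foldr (tuple_step 0) w v) = length v"
    "\<And>i. i < length v \<Longrightarrow> \<bar>foldr (tuple_step 0) w v ! i\<bar> \<le> B + int (length w)"
    using tuple_word_reduction[of v B w m] vB m B0 w len by auto
  have "foldr (tuple_step m) w (map (\<lambda>z. z mod int m) v) = map (\<lambda>z. z mod int m) v"
  proof -
    have m0: "0 < int m" unfolding m using B0 by simp
    then have "tuple_identity k m w" using T by simp
    moreover have "set (map (\<lambda>z. z mod int m) v) \<subseteq> {0..<int m}" using m0 by auto
    ultimately show ?thesis unfolding tuple_identity_def using len by (metis length_map)
  qed
  then have e: "map (\<lambda>z. z mod int m) (foldr (tuple_step 0) w v) = map (\<lambda>z. z mod int m) v"
    using red(1) by simp
  show "foldr (tuple_step 0) w v = v"
  proof (rule nth_equalityI)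
    show "length (foldr (tuple_step 0) w v) = length v" by (fact red(2))
    fix i assume "i < length (foldr (tuple_step 0) w v)"
    then have i: "i < length v" using red(2) by simp
    have "foldr (tuple_step 0) w v ! i mod int m = v ! i mod int m"
      using arg_cong[OF e, of "\<lambda>l. l ! i"] i red(2) by simp
    then have "(foldr (tuple_step 0) w v ! i - v ! i) mod int m = 0" by (simp add: mod_eq_dvd_iff)
    moreover have "\<bar>foldr (tuple_step 0) w v ! i - v ! i\<bar> < int m" using red(3)[OF i] vB[OF i] m by linarith
    ultimately show "foldr (tuple_step 0) w v ! i = v ! i" using small_mod_eq_0 by simp
  qed
qed

section \<open>Columns, belts and the moves of the heads\<close>

text \<open>A column consists of its parity bit and of the marks of the heads.\<close>

type_synonym column = "bool \<times> (nat \<Rightarrow> int)"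

text \<open>The pairs of the form \<open>(sgn (c - p), sgn (c + 1 - p))\<close>.\<close>

definition compatible_marks :: "int \<Rightarrow> int \<Rightarrow> bool" where
  "compatible_marks u v \<longleftrightarrow> (u, v) \<in> {(-1, -1), (-1, 0), (0, 1), (1, 1)}"

definition belt_break :: "nat \<Rightarrow> (int \<Rightarrow> column) \<Rightarrow> int \<Rightarrow> bool" where
  "belt_break k x c \<longleftrightarrow> fst (x c) = fst (x (c + 1)) \<or>
     (\<exists>i<k. \<not> compatible_marks (snd (x c) i) (snd (x (c + 1)) i))"

definition linked :: "nat \<Rightarrow> (int \<Rightarrow> column) \<Rightarrow> int \<Rightarrow> int \<Rightarrow> bool" where
  "linked k x c d \<longleftrightarrow> (\<forall>e. min c d \<le> e \<and> e < max c d \<longrightarrow> \<not> belt_break k x e)"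

text \<open>The cell after column \<open>c\<close> on the cycle into which the belt of \<open>c\<close> is folded, for \<open>\<epsilon> = True\<close>, and the cell before
\<open>c\<close>, for \<open>\<epsilon> = False\<close>: reversing the cycle exchanges the roles of the two parities.  Near an end of the belt a
head that cannot advance by two columns turns round and lands on a column of the other parity; on a belt of a
single column it stays.\<close>

definition belt_next :: "nat \<Rightarrow> bool \<Rightarrow> (int \<Rightarrow> column) \<Rightarrow> int \<Rightarrow> int" where
  "belt_next k \<epsilon> x c =
     (if fst (x c) = \<epsilon>
      then (if \<not> belt_break k x c then (if \<not> belt_break k x (c + 1) then c + 2 else c + 1)
            else if \<not> belt_break k x (c - 1) then c - 1 else c)
      else (if \<not> belt_break k x (c - 1) then (if \<not> belt_break k x (c - 2) then c - 2 else c - 1)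
            else if \<not> belt_break k x c then c + 1 else c))"

text \<open>Column \<open>d\<close> belongs to the belt of \<open>c\<close> and carries the whole stack of heads \<open>0, \<dots>, j - 1\<close>.  A move shifts heads by
at most two columns, so only stacks within distance \<open>2\<close> can affect the marks of \<open>c\<close>.\<close>

definition full_near :: "nat \<Rightarrow> nat \<Rightarrow> (int \<Rightarrow> column) \<Rightarrow> int \<Rightarrow> int \<Rightarrow> bool" where
  "full_near k j x c d \<longleftrightarrow> \<bar>d - c\<bar> \<le> 2 \<and> linked k x c d \<and> (\<forall>i<j. snd (x d) i = 0)"

text \<open>The stack of heads moves to its next cell, and the marks near it are recomputed as signs.  The column of the
stack is selected through its offset \<open>e\<close> from \<open>c\<close>, so that the choice visibly commutes with the shift.\<close>

definition ca_step :: "nat \<Rightarrow> nat \<times> bool \<Rightarrow> (int \<Rightarrow> column) \<Rightarrow> int \<Rightarrow> column" where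
  "ca_step k s x = (\<lambda>c. (fst (x c), \<lambda>i.
     if i < fst s \<and> (\<exists>d. full_near k (fst s) x c d)
     then sgn (c - belt_next k (snd s) x (c + (SOME e. full_near k (fst s) x c (c + e))))
     else snd (x c) i))"

definition belt :: "nat \<Rightarrow> (int \<Rightarrow> column) \<Rightarrow> int \<Rightarrow> int \<Rightarrow> bool" where
  "belt k x a b \<longleftrightarrow> a \<le> b \<and> belt_break k x (a - 1) \<and> belt_break k x b \<and> (\<forall>c. a \<le> c \<and> c < b \<longrightarrow> \<not> belt_break k x c)"

text \<open>Going once around the belt along its upper side and back along its lower side passes \<open>2 m\<close> places, \<open>m = b - a + 1\<close>;
place \<open>c - a\<close> is above column \<open>c\<close> and place \<open>2 m - 1 - (c - a)\<close> is below it.  If columns of parity \<open>True\<close> own their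
upper place and the others their lower place, then the places owned are exactly those of one residue class
modulo \<open>2\<close>, because the parities alternate.  Half of the place, rounded down, numbers them from \<open>0\<close> to \<open>m - 1\<close>.\<close>

definition belt_pos :: "(int \<Rightarrow> column) \<Rightarrow> int \<Rightarrow> int \<Rightarrow> int \<Rightarrow> int" where
  "belt_pos x a b c = (if fst (x c) then c - a else 2 * (b - a + 1) - 1 - (c - a)) div 2"

text \<open>Marks with an index beyond the heads are fixed to \<open>0\<close>, which makes the alphabet finite.\<close>

definition belt_alphabet :: "nat \<Rightarrow> column set" where
  "belt_alphabet k = {s. \<forall>i. (i < k \<longrightarrow> snd s i \<in> {-1, 0, 1}) \<and> (k \<le> i \<longrightarrow> snd s i = 0)}"

section \<open>The circuit of a belt\<close>

lemma belt_parity: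
  assumes "belt k x a b" "a \<le> c" "c \<le> b"
  shows "fst (x c) = (fst (x a) = even (c - a))"
  using assms(2,3)
proof (induction c rule: int_ge_induct)
  case base then show ?case by simp
next
  case (step c)
  then have "\<not> belt_break k x c" using assms(1) by (auto simp: belt_def)
  then have "fst (x c) \<noteq> fst (x (c+1))" by (auto simp: belt_break_def)
  moreover have "fst (x c) = (fst (x a) = even (c - a))" using step by simp
  ultimately show ?case by auto
qed

lemma belt_break_in_belt_iff:
  assumes "belt k x a b" "a - 1 \<le> c" "c \<le> b"
  shows "belt_break k x c \<longleftrightarrow> c = a - 1 \<or> c = b"
proof -
  have "a \<le> c \<and> c < b \<or> c = a - 1 \<or> c = b" using assms(2,3) by auto
  then show ?thesis using assms(1) by (auto simp: belt_def)
qed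

lemma belt_next_eq:
  assumes "belt k x a b" "a \<le> c" "c \<le> b"
  shows "belt_next k \<epsilon> x c =
    (if fst (x c) = \<epsilon> then (if c < b then (if c + 1 < b then c + 2 else c + 1) else if a < c then c - 1 else c)
     else (if a < c then (if a < c - 1 then c - 2 else c - 1) else if c < b then c + 1 else c))"
proof -
  have "belt_break k x c \<longleftrightarrow> c = b" "belt_break k x (c - 1) \<longleftrightarrow> c = a"
    using belt_break_in_belt_iff[OF assms(1), of c] belt_break_in_belt_iff[OF assms(1), of "c - 1"] assms(2,3) by auto
  moreover have "c < b \<Longrightarrow> belt_break k x (c + 1) \<longleftrightarrow> c + 1 = b"
    using belt_break_in_belt_iff[OF assms(1), of "c + 1"] assms(2,3) by auto
  moreover have "a < c \<Longrightarrow> belt_break k x (c - 2) \<longleftrightarrow> c - 1 = a"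
    using belt_break_in_belt_iff[OF assms(1), of "c - 2"] assms(2,3) by auto
  ultimately show ?thesis using assms(2,3)
    by (cases "fst (x c) = \<epsilon>"; cases "c = b"; cases "c = a") (simp_all add: belt_next_def)
qed

lemma belt_next_in_belt:
  assumes "belt k x a b" "a \<le> c" "c \<le> b"
  shows "a \<le> belt_next k \<epsilon> x c" "belt_next k \<epsilon> x c \<le> b" "\<bar>belt_next k \<epsilon> x c - c\<bar> \<le> 2"
  using assms(2,3) by (auto simp: belt_next_eq[OF assms])

lemma belt_pos_range:
  assumes "a \<le> c" "c \<le> b"
  shows "0 \<le> belt_pos x a b c" "belt_pos x a b c < b - a + 1"
  using assms by (auto simp: belt_pos_def)

lemma mod_succ_int: "0 \<le> p \<Longrightarrow> p < m \<Longrightarrow> (p + 1) mod m = (if p + 1 = m then 0 else p + 1)" for p m :: int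
  by auto

lemma mod_pred_int: "0 \<le> p \<Longrightarrow> p < m \<Longrightarrow> (p - 1) mod m = (if p = 0 then m - 1 else p - 1)" for p m :: int
  by (auto simp: zmod_minus1)

lemma div2_even: "even z \<Longrightarrow> z div 2 = p \<longleftrightarrow> z = 2 * p" for z p :: int by auto
lemma div2_odd: "odd z \<Longrightarrow> z div 2 = p \<longleftrightarrow> z = 2 * p + 1" for z p :: int by (auto elim!: oddE)

text \<open>The numbering of the cycle without division, for the column at distance \<open>t\<close> from the left end of a belt of length
\<open>m\<close> whose first column has parity \<open>P\<close>.\<close>

lemma circuit_pos_eq_iff: fixes t m :: int
  shows "(if P = even t then t else 2 * m - 1 - t) div 2 = p \<longleftrightarrow>
     t = (if P = even t then 2 * p + (if P then 0 else 1) else 2 * m - 1 - 2 * p - (if P then 0 else 1))"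
  by (cases P; cases "even t") (auto simp: div2_even div2_odd)

lemma circuit_pos_succ: fixes t m :: int assumes t: "0 \<le> t" "t < m"
 and d: "d = (if (P = even t) then (if t + 1 < m then (if t + 2 < m then t + 2 else t + 1) else if 0 < t then t - 1 else t)
     else (if 0 < t then (if 1 < t then t - 2 else t - 1) else if t + 1 < m then t + 1 else t))"
 and p: "p = (if (P = even t) then t else 2 * m - 1 - t) div 2"
 shows "(if (P = even d) then d else 2 * m - 1 - d) div 2 = (if p + 1 = m then 0 else p + 1)"
  unfolding circuit_pos_eq_iff
  using p[symmetric] t unfolding circuit_pos_eq_iff 
  by (cases P; cases "even t") (auto simp: d split: if_splits, (linarith | arith)+)

lemma circuit_pos_pred: fixes t m :: int assumes t: "0 \<le> t" "t < m"
 and d: "d = (if (P \<noteq> even t) then (if t + 1 < m then (if t + 2 < m then t + 2 else t + 1) else if 0 < t then t - 1 else t)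
     else (if 0 < t then (if 1 < t then t - 2 else t - 1) else if t + 1 < m then t + 1 else t))"
 and p: "p = (if (P = even t) then t else 2 * m - 1 - t) div 2"
 shows "(if (P = even d) then d else 2 * m - 1 - d) div 2 = (if p = 0 then m - 1 else p - 1)"
  unfolding circuit_pos_eq_iff
  using p[symmetric] t unfolding circuit_pos_eq_iff 
  by (cases P; cases "even t") (auto simp: d split: if_splits)

text \<open>As \<open>belt_pos\<close> numbers the columns of a belt of length \<open>m\<close> by \<open>0, \<dots>, m - 1\<close>, this shows that all of them lie on a
single cycle.\<close>

lemma belt_pos_next:
  assumes "belt k x a b" "a \<le> c" "c \<le> b"
  shows "belt_pos x a b (belt_next k \<epsilon> x c) = (belt_pos x a b c + (if \<epsilon> then 1 else -1)) mod (b - a + 1)"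
proof -
  define t where "t = c - a"
  define m where "m = b - a + 1"
  define P where "P = fst (x a)"
  have c: "c = a + t" and b: "b = a + m - 1" and t: "0 \<le> t" "t < m" using assms(2,3) by (auto simp: t_def m_def)
  have par: "fst (x (a + d)) = (P = even d)" if "0 \<le> d" "d < m" for d
    using belt_parity[OF assms(1), of "a + d"] that by (auto simp: P_def b)
  have n: "belt_next k \<epsilon> x c = a + (if (P = even t) = \<epsilon> then (if t + 1 < m then (if t + 2 < m then t + 2 else t + 1) else if 0 < t then t - 1 else t)
     else (if 0 < t then (if 1 < t then t - 2 else t - 1) else if t + 1 < m then t + 1 else t))"
    unfolding belt_next_eq[OF assms] using par[OF t] c b t by auto
  have pos: "belt_pos x a b (a + d) = (if (P = even d) then d else 2 * m - 1 - d) div 2" if "0 \<le> d" "d < m" for d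
    unfolding belt_pos_def using par[OF that] b by auto
  define d where "d = belt_next k \<epsilon> x c - a"
  have d: "d = (if (P = even t) = \<epsilon> then (if t + 1 < m then (if t + 2 < m then t + 2 else t + 1) else if 0 < t then t - 1 else t)
     else (if 0 < t then (if 1 < t then t - 2 else t - 1) else if t + 1 < m then t + 1 else t))"
    using n d_def by simp
  have dr: "0 \<le> d" "d < m" using t unfolding d by (auto split: if_splits)
  have "belt_next k \<epsilon> x c = a + d" by (simp add: d_def)
  then have L: "belt_pos x a b (belt_next k \<epsilon> x c) = (if (P = even d) then d else 2 * m - 1 - d) div 2"
    using pos[OF dr] by simp
  define p where "p = belt_pos x a b c"
  have p: "p = (if (P = even t) then t else 2 * m - 1 - t) div 2" using pos[OF t] by (simp add: p_def c)
  have pr: "0 \<le> p" "p < m" using belt_pos_range[OF assms(2,3)] by (simp_all add: p_def m_def)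
  have "(if (P = even d) then d else 2 * m - 1 - d) div 2 = (p + (if \<epsilon> then 1 else -1)) mod m"
  proof (cases \<epsilon>)
    case True
    have "(if (P = even d) then d else 2 * m - 1 - d) div 2 = (if p + 1 = m then 0 else p + 1)"
      by (rule circuit_pos_succ[OF t _ p]) (simp only: d True eq_True)
    then show ?thesis using True by (simp only: mod_succ_int[OF pr] if_True)
  next
    case False
    have "(if (P = even d) then d else 2 * m - 1 - d) div 2 = (if p = 0 then m - 1 else p - 1)"
      by (rule circuit_pos_pred[OF t _ p]) (simp only: d False eq_False)
    then show ?thesis using False mod_pred_int[OF pr] by (simp only: if_False) simp
  qed
  then show ?thesis using L by (simp add: p_def m_def)
qed

text \<open>Two columns of the same parity with the same number are equal.  Columns of different parities with the same number
would have distances \<open>t, s < m\<close> from the left end that add up to \<open>2 m - 1\<close>.\<close>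

lemma belt_pos_inj:
  assumes "belt k x a b" "a \<le> c" "c \<le> b" "a \<le> d" "d \<le> b" "belt_pos x a b c = belt_pos x a b d"
  shows "c = d"
proof -
  define t s m where "t = c - a" and "s = d - a" and "m = b - a + 1"
  have "belt_pos x a b c = (if fst (x a) = even t then t else 2 * m - 1 - t) div 2"
    "belt_pos x a b d = (if fst (x a) = even s then s else 2 * m - 1 - s) div 2"
    using belt_parity[OF assms(1-3)] belt_parity[OF assms(1,4,5)]
    unfolding belt_pos_def t_def s_def m_def by auto
  then have p: "t = (if fst (x a) = even t then U else V)" "s = (if fst (x a) = even s then U else V)"
    if "U = 2 * belt_pos x a b c + (if fst (x a) then 0 else 1)"
      "V = 2 * m - 1 - 2 * belt_pos x a b c - (if fst (x a) then 0 else 1)" for U V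
    using circuit_pos_eq_iff[of "fst (x a)" t m "belt_pos x a b c"] circuit_pos_eq_iff[of "fst (x a)" s m "belt_pos x a b c"] assms(6) that
    by metis+
  define U where "U = 2 * belt_pos x a b c + (if fst (x a) then 0 else 1)"
  define V where "V = 2 * m - 1 - 2 * belt_pos x a b c - (if fst (x a) then 0 else 1)"
  have t: "t = (if fst (x a) = even t then U else V)" and s: "s = (if fst (x a) = even s then U else V)"
    using p[OF U_def V_def] by blast+
  have UV: "U + V = 2 * m - 1" by (simp add: U_def V_def)
  have "t < m" "s < m" using assms(3,5) by (simp_all add: t_def s_def m_def)
  then have ne: "t + s \<noteq> U + V" using UV by linarith
  have "t = s"
  proof (cases "(fst (x a) = even t) = (fst (x a) = even s)")
    case True
    then show ?thesis using t s by presburger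
  next
    case False
    then have "t + s = U + V" using t s by (metis add.commute)
    then show ?thesis using ne by contradiction
  qed
  then show ?thesis by (simp add: t_def s_def)
qed

lemma belt_pos_surj:
  assumes "belt k x a b" "0 \<le> p" "p < b - a + 1"
  shows "\<exists>c. a \<le> c \<and> c \<le> b \<and> belt_pos x a b c = p"
proof -
  have "inj_on (belt_pos x a b) {a..b}"
  proof (rule inj_onI)
    fix c d assume "c \<in> {a..b}" "d \<in> {a..b}" "belt_pos x a b c = belt_pos x a b d"
    then show "c = d" using belt_pos_inj[OF assms(1), of c d] by simp
  qed
  moreover have "belt_pos x a b ` {a..b} \<subseteq> {0..<b - a + 1}"
    using belt_pos_range[of a _ b x] by (intro image_subsetI) (simp only: atLeastAtMost_iff atLeastLessThan_iff simp_thms)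
  ultimately have "belt_pos x a b ` {a..b} = {0..<b - a + 1}"
    by (intro card_subset_eq) (auto simp: card_image)
  moreover have "p \<in> {0..<b - a + 1}" using assms(2,3) by simp
  ultimately have "p \<in> belt_pos x a b ` {a..b}" by blast
  then show ?thesis by auto
qed

section \<open>The action of a move on a belt\<close>

text \<open>The marks on the belt from \<open>a\<close> to \<open>b\<close> are those of heads at the positions \<open>P\<close>.  A missing head is recorded at the
position \<open>a - 1\<close> or \<open>b + 1\<close> just outside of the belt, which yields the right constant marks and makes \<open>P\<close> unique.\<close>

definition has_heads :: "nat \<Rightarrow> (int \<Rightarrow> column) \<Rightarrow> int \<Rightarrow> int \<Rightarrow> (nat \<Rightarrow> int) \<Rightarrow> bool" where
  "has_heads k x a b P \<longleftrightarrow> (\<forall>i<k. P i \<in> {a - 1..b + 1} \<and> (\<forall>c\<in>{a..b}. snd (x c) i = sgn (c - P i)))"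

text \<open>The effect of a move on the head positions, where \<open>\<rho>\<close> is the permutation of the columns of the belt.\<close>

definition heads_step :: "nat \<Rightarrow> int \<Rightarrow> int \<Rightarrow> (int \<Rightarrow> int) \<Rightarrow> (nat \<Rightarrow> int) \<Rightarrow> nat \<Rightarrow> int" where
  "heads_step j a b \<rho> P =
     (if (\<forall>i<j. P i = P 0) \<and> P 0 \<in> {a..b} then (\<lambda>i. if i < j then \<rho> (P 0) else P i) else P)"

lemma sgn_shift: "\<bar>c - p\<bar> > 2 \<Longrightarrow> \<bar>q - p\<bar> \<le> 2 \<Longrightarrow> sgn (c - p) = sgn (c - q)" for c p q :: int
  by (auto simp: sgn_if)

lemma ca_step_none:
  "(\<And>d. \<not> full_near k (fst s) x c d) \<Longrightarrow> snd (ca_step k s x c) i = snd (x c) i"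
  unfolding ca_step_def by auto

lemma ca_step_some:
  assumes "\<And>d. full_near k (fst s) x c d \<longleftrightarrow> d = p"
  shows "snd (ca_step k s x c) i = (if i < fst s then sgn (c - belt_next k (snd s) x p) else snd (x c) i)"
proof -
  have "(SOME e. full_near k (fst s) x c (c + e)) = p - c"
    unfolding assms by (rule some_equality) auto
  then show ?thesis using assms by (auto simp: ca_step_def)
qed

text \<open>The local rule updates marks only near the stack.  Further away nothing has to change: a column at distance more than
\<open>2\<close> from the stack sees it on the same side before and after the move.\<close>

lemma ca_step_has_heads:
  assumes B: "belt k x a b" and R: "has_heads k x a b P" and j: "1 \<le> fst s" "fst s \<le> k"
  shows "has_heads k (ca_step k s x) a b (heads_step (fst s) a b (belt_next k (snd s) x) P)"
proof -
  define j where "j = fst s"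
  have mark: "snd (x c) i = sgn (c - P i)" if "c \<in> {a..b}" "i < k" for c i using R that by (auto simp: has_heads_def)
  have Pr: "P i \<in> {a - 1..b + 1}" if "i < k" for i using R that by (auto simp: has_heads_def)
  have near_in: "d \<in> {a..b} \<and> (\<forall>i<j. P i = d)" if "full_near k j x c d" "c \<in> {a..b}" for c d
  proof -
    have l: "linked k x c d" and z: "\<forall>i<j. snd (x d) i = 0" using that by (auto simp: full_near_def)
    have "\<not> d < a"
    proof
      assume "d < a"
      then have "\<not> belt_break k x (a - 1)" using l that(2) by (auto simp: linked_def)
      then show False using B by (simp add: belt_def)
    qed
    moreover have "\<not> b < d"
    proof
      assume "b < d"
      then have "\<not> belt_break k x b" using l that(2) by (auto simp: linked_def)
      then show False using B by (simp add: belt_def)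
    qed
    ultimately have d: "d \<in> {a..b}" by auto
    moreover have "P i = d" if "i < j" for i
      using z mark[OF d, of i] that assms(4) by (auto simp: j_def sgn_if split: if_splits)
    ultimately show ?thesis by blast
  qed
  have near: "full_near k j x c d \<longleftrightarrow> \<bar>d - c\<bar> \<le> 2 \<and> d \<in> {a..b} \<and> (\<forall>i<j. P i = d)" if c: "c \<in> {a..b}" for c d
  proof
    assume r: "\<bar>d - c\<bar> \<le> 2 \<and> d \<in> {a..b} \<and> (\<forall>i<j. P i = d)"
    then have "snd (x d) i = 0" if "i < j" for i using that mark[of d i] assms(4) by (auto simp: j_def)
    moreover have "a \<le> min c d" "max c d \<le> b" using r c by auto
    then have lk: "a \<le> e \<and> e < b" if "min c d \<le> e" "e < max c d" for e
      using that by linarith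
    have "linked k x c d" using B lk unfolding linked_def belt_def by blast
    ultimately show "full_near k j x c d" using r by (simp add: full_near_def)
  qed (use near_in[OF _ c] in \<open>auto simp: full_near_def\<close>)
  have j0: "0 < j" using assms(3) by (simp add: j_def)
  show ?thesis
  proof (cases "(\<forall>i<j. P i = P 0) \<and> P 0 \<in> {a..b}")
    case True
    define q where "q = belt_next k (snd s) x (P 0)"
    have "a \<le> P 0" "P 0 \<le> b" using conjunct2[OF True] by simp_all
    then have q: "a \<le> q" "q \<le> b" "\<bar>q - P 0\<bar> \<le> 2" unfolding q_def by (rule belt_next_in_belt[OF B])+
    have nr: "full_near k j x c d \<longleftrightarrow> \<bar>P 0 - c\<bar> \<le> 2 \<and> d = P 0" if "c \<in> {a..b}" for c d
      unfolding near[OF that] using True j0 by metis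
    have "snd (ca_step k s x c) i = sgn (c - (if i < j then q else P i))" if c: "c \<in> {a..b}" and i: "i < k" for c i
    proof (cases "\<bar>P 0 - c\<bar> \<le> 2")
      case near': True
      have "snd (ca_step k s x c) i = (if i < fst s then sgn (c - belt_next k (snd s) x (P 0)) else snd (x c) i)"
        by (rule ca_step_some) (simp only: nr[OF c] near' simp_thms j_def[symmetric])
      then show ?thesis unfolding mark[OF c i] j_def q_def by simp
    next
      case False
      then have "\<not> full_near k (fst s) x c d" for d using nr[OF c] by (simp add: j_def)
      then have "snd (ca_step k s x c) i = sgn (c - P i)" unfolding mark[OF c i, symmetric] by (rule ca_step_none)
      moreover have "sgn (c - P i) = sgn (c - q)" if "i < j"
      proof -
        have "P i = P 0" using True that by blast
        then show ?thesis using sgn_shift[of c "P 0" q] False q(3) by simp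
      qed
      ultimately show ?thesis by auto
    qed
    moreover have "heads_step (fst s) a b (belt_next k (snd s) x) P = (\<lambda>i. if i < j then q else P i)"
      using if_P[OF True] unfolding heads_step_def j_def q_def by metis
    moreover have "(if i < j then q else P i) \<in> {a - 1..b + 1}" if "i < k" for i
      using q Pr[OF that] by simp
    ultimately show ?thesis by (simp add: has_heads_def)
  next
    case False
    have none: "\<not> full_near k (fst s) x c d" if "c \<in> {a..b}" for c d
      using near[OF that] False j0 unfolding j_def by metis
    have "snd (ca_step k s x c) i = sgn (c - P i)" if "c \<in> {a..b}" "i < k" for c i
      unfolding mark[OF that, symmetric] by (rule ca_step_none[OF none[OF that(1)]])
    moreover have "heads_step (fst s) a b (belt_next k (snd s) x) P = P"
      using if_not_P[OF False] unfolding heads_step_def j_def by metis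
    ultimately show ?thesis using Pr by (simp add: has_heads_def)
  qed
qed

text \<open>Along a belt the marks of one head can only read \<open>-1, \<dots>, -1, 0, 1, \<dots>, 1\<close>, where each of the three parts may be missing,
but \<open>-1\<close> is never followed directly by \<open>1\<close>.\<close>

lemma belt_has_heads:
  assumes B: "belt k x a b" and X: "\<And>c. x c \<in> belt_alphabet k"
  shows "\<exists>P. has_heads k x a b P"
proof -
  have "\<exists>p\<in>{a-1..b+1}. \<forall>c\<in>{a..b}. snd (x c) i = sgn (c - p)" if i: "i < k" for i
  proof -
    define u where "u c = snd (x c) i" for c
    have u: "u c \<in> {-1,0,1}" for c using X[of c] i by (auto simp: belt_alphabet_def u_def)
    have st: "compatible_marks (u c) (u (c+1))" if "a \<le> c" "c < b" for c
      using B that i by (auto simp: belt_def belt_break_def u_def)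
    have "e \<le> b \<longrightarrow> (\<exists>p\<in>{a-1..e+1}. \<forall>c\<in>{a..e}. u c = sgn (c - p))" if "a \<le> e" for e
      using that
    proof (induction e rule: int_ge_induct)
      case base
      consider "u a = -1" | "u a = 0" | "u a = 1" using u[of a] by auto
      then show ?case
      proof cases
        case 1 then show ?thesis by (intro impI bexI[of _ "a+1"]) auto
      next
        case 2 then show ?thesis by (intro impI bexI[of _ "a"]) auto
      next
        case 3 then show ?thesis by (intro impI bexI[of _ "a-1"]) auto
      qed
    next
      case (step e)
      show ?case
      proof
        assume e: "e + 1 \<le> b"
        then obtain p where p: "p\<in>{a-1..e+1}" "\<forall>c\<in>{a..e}. u c = sgn (c - p)" using step by auto
        have ue: "u e = sgn (e - p)" using p step by auto
        have pe: "p = e + 1" if "u e = -1" using ue p that by (auto simp: sgn_if split: if_splits)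
        have c: "compatible_marks (u e) (u (e+1))" using st[of e] e step by auto
        have ext: "\<exists>p\<in>{a-1..e+1+1}. \<forall>c\<in>{a..e+1}. u c = sgn (c - p)"
          if "p' \<in> {a-1..e+1+1}" "\<forall>c\<in>{a..e}. u c = sgn (c - p')" "u (e+1) = sgn (e + 1 - p')" for p'
        proof (rule bexI[OF _ that(1)], rule ballI)
          fix c assume "c \<in> {a..e+1}"
          then show "u c = sgn (c - p')" using that by (cases "c = e + 1") auto
        qed
        show "\<exists>p\<in>{a-1..e+1+1}. \<forall>c\<in>{a..e+1}. u c = sgn (c - p)"
        proof (cases "u e = -1 \<and> u (e+1) = -1")
          case True
          then have "p = e + 1" using pe by blast
          then have "u c = sgn (c - (e + 2))" if "c \<in> {a..e}" for c
            using p(2) that by (simp add: sgn_if)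
          then show ?thesis using True step(1) by (intro ext[of "e+2"]) simp_all
        next
          case False
          have "p < e \<or> p = e \<or> p = e + 1" using p(1) by auto
          then have "u (e+1) = sgn (e + 1 - p)"
          proof (elim disjE)
            assume "p < e"
            then show ?thesis using c unfolding ue compatible_marks_def by simp
          next
            assume "p = e"
            then show ?thesis using c unfolding ue compatible_marks_def by simp
          next
            assume "p = e + 1"
            then show ?thesis using c False unfolding ue compatible_marks_def by auto
          qed
          then show ?thesis using p by (intro ext[of p]) simp_all
        qed
      qed
    qed
    then show ?thesis using B by (auto simp: belt_def u_def)
  qed
  then obtain P where "\<forall>i<k. P i \<in> {a-1..b+1} \<and> (\<forall>c\<in>{a..b}. snd (x c) i = sgn (c - P i))"
    by metis
  then show ?thesis by (auto simp: has_heads_def)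
qed

definition breaks_outside_window :: "nat \<Rightarrow> (int \<Rightarrow> column) \<Rightarrow> bool" where
  "breaks_outside_window k x \<longleftrightarrow> (\<exists>N. \<forall>c. N \<le> \<bar>c\<bar> \<longrightarrow> belt_break k x c)"

text \<open>The belt of \<open>c\<close> ends at the first break at or after \<open>c\<close> and starts behind the last break before \<open>c\<close>.\<close>

lemma belt_exists:
  assumes "breaks_outside_window k x"
  shows "\<exists>a b. belt k x a b \<and> a \<le> c \<and> c \<le> b"
proof -
  obtain N where N: "\<And>c. N \<le> \<bar>c\<bar> \<Longrightarrow> belt_break k x c" using assms by (auto simp: breaks_outside_window_def)
  define A where "A = {d. d < c \<and> - \<bar>N\<bar> - \<bar>c\<bar> - 1 \<le> d \<and> belt_break k x d}"
  define B where "B = {d. c \<le> d \<and> d \<le> \<bar>N\<bar> + \<bar>c\<bar> \<and> belt_break k x d}"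
  have fA: "finite A" by (rule finite_subset[of _ "{- \<bar>N\<bar> - \<bar>c\<bar> - 1..<c}"]) (auto simp: A_def)
  have fB: "finite B" by (rule finite_subset[of _ "{c..\<bar>N\<bar> + \<bar>c\<bar>}"]) (auto simp: B_def)
  have "- \<bar>N\<bar> - \<bar>c\<bar> - 1 \<in> A" using N by (auto simp: A_def)
  then have A: "Max A \<in> A" "\<And>d. d \<in> A \<Longrightarrow> d \<le> Max A" using fA by (auto intro: Max_in)
  have "\<bar>N\<bar> + \<bar>c\<bar> \<in> B" using N by (auto simp: B_def)
  then have Bm: "Min B \<in> B" "\<And>d. d \<in> B \<Longrightarrow> Min B \<le> d" using fB by (auto intro: Min_in)
  have "belt k x (Max A + 1) (Min B)"
    unfolding belt_def
  proof (intro conjI allI impI)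
    show "Max A + 1 \<le> Min B" "belt_break k x (Max A + 1 - 1)" "belt_break k x (Min B)" using A(1) Bm(1) by (auto simp: A_def B_def)
    fix d assume d: "Max A + 1 \<le> d \<and> d < Min B"
    show "\<not> belt_break k x d"
    proof
      assume br: "belt_break k x d"
      have "d \<notin> A" "d \<notin> B" using d A(2)[of d] Bm(2)[of d] by auto
      then show False using br d A(1) Bm(1) by (auto simp: A_def B_def)
    qed
  qed
  moreover have "Max A < c" using A(1) unfolding A_def by simp
  moreover have "c \<le> Min B" using Bm(1) unfolding B_def by simp
  ultimately show ?thesis by (intro exI[of _ "Max A + 1"] exI[of _ "Min B"]) simp
qed

lemma ca_step_fst [simp]: "fst (ca_step k s x c) = fst (x c)"
  by (simp add: ca_step_def)

lemma heads_step_cases: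
  assumes "\<And>c. c \<in> {a..b} \<Longrightarrow> \<rho> c \<in> {a..b}"
  shows "heads_step j a b \<rho> P i = P i \<or> (P i \<in> {a..b} \<and> heads_step j a b \<rho> P i \<in> {a..b})"
proof (cases "(\<forall>i<j. P i = P 0) \<and> P 0 \<in> {a..b}")
  case True
  then have "P i \<in> {a..b}" if "i < j" using that by metis
  moreover have "\<rho> (P 0) \<in> {a..b}" using assms True by blast
  ultimately show ?thesis unfolding heads_step_def if_P[OF True] by simp
next
  case False
  then show ?thesis by (simp only: heads_step_def if_False simp_thms)
qed

text \<open>Inside a belt the new marks still come from common head positions.  At the right end of a belt, the mark of a head
changes only if the head stays on the belt, so only between \<open>0\<close> and \<open>1\<close>; both are compatible with a right
neighbour \<open>1\<close> and with nothing else.  Symmetrically, marks at a left end change only between \<open>-1\<close> and \<open>0\<close>, which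
are both compatible exactly with a left neighbour \<open>-1\<close>.  So changes on one or both sides of a cut never close it.\<close>

lemma ca_step_belt_break:
  assumes F: "breaks_outside_window k x" and X: "\<And>c. x c \<in> belt_alphabet k" and s: "1 \<le> fst s" "fst s \<le> k"
  shows "belt_break k (ca_step k s x) c \<longleftrightarrow> belt_break k x c"
proof -
  obtain a b where B: "belt k x a b" "a \<le> c" "c \<le> b" using belt_exists[OF F] by blast
  obtain P where P: "has_heads k x a b P" using belt_has_heads[OF B(1) X] by blast
  define P' where "P' = heads_step (fst s) a b (belt_next k (snd s) x) P"
  have P': "has_heads k (ca_step k s x) a b P'" unfolding P'_def by (rule ca_step_has_heads[OF B(1) P s])
  have PP: "P' i = P i \<or> (P i \<in> {a..b} \<and> P' i \<in> {a..b})" for i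
    unfolding P'_def by (rule heads_step_cases) (use belt_next_in_belt[OF B(1)] in auto)
  have mk: "snd (x d) i = sgn (d - P i)" "snd (ca_step k s x d) i = sgn (d - P' i)" if "d \<in> {a..b}" "i < k" for d i
    using P P' that by (auto simp: has_heads_def)
  show ?thesis
  proof (cases "belt_break k x c")
    case False
    then have c: "c \<in> {a..b}" "c + 1 \<in> {a..b}" using B belt_break_in_belt_iff[OF B(1), of c] by auto
    have "compatible_marks (snd (ca_step k s x c) i) (snd (ca_step k s x (c+1)) i)" if "i < k" for i
      using mk(2)[OF c(1) that] mk(2)[OF c(2) that] by (auto simp: compatible_marks_def sgn_if)
    then show ?thesis using False by (auto simp: belt_break_def)
  next
    case True
    then have cb: "c = b" using B belt_break_in_belt_iff[OF B(1), of c] by auto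
    obtain a2 b2 where B2: "belt k x a2 b2" "a2 \<le> c + 1" "c + 1 \<le> b2" using belt_exists[OF F] by blast
    have a2: "a2 = c + 1"
    proof (rule ccontr)
      assume "a2 \<noteq> c + 1"
      then have "a2 \<le> c \<and> c < b2" using B2(2,3) by linarith
      then show False using True B2(1) unfolding belt_def by blast
    qed
    obtain Q where Q: "has_heads k x a2 b2 Q" using belt_has_heads[OF B2(1) X] by blast
    define Q' where "Q' = heads_step (fst s) a2 b2 (belt_next k (snd s) x) Q"
    have Q': "has_heads k (ca_step k s x) a2 b2 Q'" unfolding Q'_def by (rule ca_step_has_heads[OF B2(1) Q s])
    have QQ: "Q' i = Q i \<or> (Q i \<in> {a2..b2} \<and> Q' i \<in> {a2..b2})" for i
      unfolding Q'_def by (rule heads_step_cases) (use belt_next_in_belt[OF B2(1)] in auto)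
    have mk2: "snd (x d) i = sgn (d - Q i)" "snd (ca_step k s x d) i = sgn (d - Q' i)" if "d \<in> {a2..b2}" "i < k" for d i
      using Q Q' that by (auto simp: has_heads_def)
    have "compatible_marks (snd (ca_step k s x c) i) (snd (ca_step k s x (c+1)) i) \<longleftrightarrow>
          compatible_marks (snd (x c) i) (snd (x (c+1)) i)" if "i < k" for i
    proof -
      have "c \<in> {a..b}" "c + 1 \<in> {a2..b2}" using B B2 by auto
      note m = mk[OF this(1) that] mk2[OF this(2) that]
      show ?thesis unfolding m using PP[of i] QQ[of i] a2 cb
        by (auto simp: compatible_marks_def sgn_if split: if_splits)
    qed
    then show ?thesis by (auto simp: belt_break_def)
  qed
qed

section \<open>Heads on a belt simulate tuples\<close>

lemma mod_eq_imp_eq: "0 \<le> p \<Longrightarrow> p < m \<Longrightarrow> 0 \<le> q \<Longrightarrow> q < m \<Longrightarrow> (p - r) mod m = (q - r) mod m \<Longrightarrow> p = q" for p q m r :: int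
  by (metis diff_add_cancel mod_add_left_eq mod_pos_pos_trivial)

text \<open>The value \<open>0\<close> for \<open>i = k\<close> is the position of the imaginary pinned head.  Missing heads get the same value, which is
just as good, since they do not move either.\<close>

definition head_pos :: "nat \<Rightarrow> (int \<Rightarrow> column) \<Rightarrow> int \<Rightarrow> int \<Rightarrow> (nat \<Rightarrow> int) \<Rightarrow> nat \<Rightarrow> int" where
  "head_pos k x a b P i = (if i < k \<and> P i \<in> {a..b} then belt_pos x a b (P i) else 0)"

text \<open>Entry \<open>i\<close> of \<open>v\<close> is prescribed only if none of the heads \<open>0, \<dots>, i\<close> is missing; the other entries are arbitrary.\<close>

definition has_coordinates :: "nat \<Rightarrow> (int \<Rightarrow> column) \<Rightarrow> int \<Rightarrow> int \<Rightarrow> (nat \<Rightarrow> int) \<Rightarrow> int list \<Rightarrow> bool" where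
  "has_coordinates k x a b P v \<longleftrightarrow> length v = k \<and>
     (\<forall>i<k. (\<forall>l\<le>i. P l \<in> {a..b}) \<longrightarrow>
        v ! i = (head_pos k x a b P i - head_pos k x a b P (Suc i)) mod (b - a + 1))"

text \<open>The invariant that the heads at and beyond the first missing one never move, and that no head enters or leaves the
belt.\<close>

definition same_active_heads :: "nat \<Rightarrow> int \<Rightarrow> int \<Rightarrow> (nat \<Rightarrow> int) \<Rightarrow> (nat \<Rightarrow> int) \<Rightarrow> bool" where
  "same_active_heads k a b P0 P \<longleftrightarrow> (\<forall>i<k. (P i \<in> {a..b} \<longleftrightarrow> P0 i \<in> {a..b}) \<and>
     ((\<exists>l\<le>i. P0 l \<notin> {a..b}) \<longrightarrow> P i = P0 i))"

lemma head_pos_range: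
  assumes "a \<le> b"
  shows "0 \<le> head_pos k x a b P i" "head_pos k x a b P i < b - a + 1"
  using assms belt_pos_range[of a "P i" b x] by (auto simp: head_pos_def)

text \<open>If the heads \<open>0, \<dots>, j - 1\<close> form a stack, then the differences between them vanish, the generator acts on the tuple, and
advancing the stack changes the difference between head \<open>j - 1\<close> and head \<open>j\<close> only.  If they do not form a stack but the
generator acts on the tuple, then one of these heads is missing: otherwise the vanishing differences would put
all of them into one cell.  In this case the coordinate that the generator changes is not prescribed.\<close>

lemma heads_step_coordinates:
  assumes B: "belt k x a b" and j: "1 \<le> j" "j \<le> k" and R: "has_coordinates k x a b P v"
  shows "has_coordinates k x a b (heads_step j a b (belt_next k \<epsilon> x) P) (tuple_step (nat (b - a + 1)) (j, \<epsilon>) v)"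
proof -
  define m where "m = b - a + 1"
  define e :: int where "e = (if \<epsilon> then 1 else -1)"
  have ab: "a \<le> b" using B by (simp add: belt_def)
  have m: "int (nat (b - a + 1)) = m" using ab by (simp add: m_def)
  have len: "length v = k" using R by (simp add: has_coordinates_def)
  have val: "v ! i = (head_pos k x a b P i - head_pos k x a b P (Suc i)) mod m"
    if "i < k" "\<And>l. l \<le> i \<Longrightarrow> P l \<in> {a..b}" for i using R that by (auto simp: has_coordinates_def m_def)
  have st: "tuple_step (nat (b - a + 1)) (j, \<epsilon>) v =
     (if \<forall>i < j - 1. v ! i = 0 then v[j - 1 := (v ! (j - 1) + e) mod m] else v)"
    by (simp only: tuple_step_def m e_def fst_conv snd_conv)
  show ?thesis
  proof (cases "(\<forall>i<j. P i = P 0) \<and> P 0 \<in> {a..b}")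
    case True
    define q where "q = belt_next k \<epsilon> x (P 0)"
    define P' where "P' = heads_step j a b (belt_next k \<epsilon> x) P"
    have P': "P' i = (if i < j then q else P i)" for i
      unfolding P'_def heads_step_def q_def if_P[OF True] ..
    have P0: "P 0 \<in> {a..b}" using True by blast
    then have q: "q \<in> {a..b}" using belt_next_in_belt[OF B, of "P 0"] by (simp add: q_def)
    have qpos: "belt_pos x a b q = (belt_pos x a b (P 0) + e) mod m"
      unfolding q_def e_def m_def by (rule belt_pos_next[OF B]) (use P0 in simp_all)
    have Pj: "P i = P 0" if "i < j" for i using True that by blast
    have zero: "v ! i = 0" if "i < j - 1" for i
    proof -
      have "P i = P 0" "P (Suc i) = P 0" "i < k" "Suc i < k" using that j Pj[of i] Pj[of "Suc i"] by auto
      moreover have "P l \<in> {a..b}" if "l \<le> i" for l using that \<open>i < j - 1\<close> Pj[of l] P0 by auto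
      ultimately show ?thesis using val[of i] by (simp add: head_pos_def)
    qed
    then have st': "tuple_step (nat (b - a + 1)) (j, \<epsilon>) v = v[j - 1 := (v ! (j - 1) + e) mod m]"
      unfolding st by simp
    have hp': "head_pos k x a b P' i = head_pos k x a b P i" if "j \<le> i" for i
      using that by (simp add: head_pos_def P')
    have hq: "head_pos k x a b P' i = belt_pos x a b q" if "i < j" for i
      using that q j by (simp add: head_pos_def P')
    have "v[j - 1 := (v ! (j - 1) + e) mod m] ! i = (head_pos k x a b P' i - head_pos k x a b P' (Suc i)) mod m"
      if i: "i < k" and pr: "\<And>l. l \<le> i \<Longrightarrow> P' l \<in> {a..b}" for i
    proof -
      have pr': "P l \<in> {a..b}" if "l \<le> i" for l
        using pr[OF that] Pj[of l] P0 by (cases "l < j") (auto simp: P')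
      consider "i < j - 1" | "i = j - 1" | "j \<le> i" by linarith
      then show ?thesis
      proof cases
        case 1 then show ?thesis using zero hq[of i] hq[of "Suc i"] by simp
      next
        case 2
        then have "Suc i = j" using j by simp
        have "head_pos k x a b P i = belt_pos x a b (P 0)" using i 2 j Pj[of i] P0 by (simp add: head_pos_def)
        then have "(v ! (j - 1) + e) mod m = (belt_pos x a b (P 0) - head_pos k x a b P j + e) mod m"
          using val[OF i pr'] 2 \<open>Suc i = j\<close> by (simp add: mod_simps)
        also have "\<dots> = (belt_pos x a b q - head_pos k x a b P j) mod m"
          unfolding qpos by (simp add: mod_simps algebra_simps)
        finally show ?thesis using 2 \<open>Suc i = j\<close> hq[of i] hp'[of j] j len by simp
      next
        case 3 then show ?thesis using val[OF i pr'] hp'[of i] hp'[of "Suc i"] j by simp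
      qed
    qed
    then show ?thesis unfolding st' P'_def[symmetric] using len by (auto simp: has_coordinates_def m_def)
  next
    case False
    then have P': "heads_step j a b (belt_next k \<epsilon> x) P = P" unfolding heads_step_def by (rule if_not_P)
    show ?thesis
    proof (cases "\<forall>i<j - 1. v ! i = 0")
      case zero: True
      have "\<exists>l\<le>j - 1. P l \<notin> {a..b}"
      proof (rule ccontr)
        assume "\<not> ?thesis"
        then have pr: "P l \<in> {a..b}" if "l \<le> j - 1" for l using that by blast
        have st: "P (Suc i) = P i" if i: "i < j - 1" for i
        proof -
          have "(head_pos k x a b P i - head_pos k x a b P (Suc i)) mod m = 0"
          proof -
            have "v ! i = (head_pos k x a b P i - head_pos k x a b P (Suc i)) mod m"
            proof (rule val)
              show "i < k" using i j by linarith
              show "P l \<in> {a..b}" if "l \<le> i" for l using that i by (intro pr) linarith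
            qed
            then show ?thesis using zero i by metis
          qed
          then have "(head_pos k x a b P i - head_pos k x a b P (Suc i)) mod (b - a + 1) =
              (head_pos k x a b P (Suc i) - head_pos k x a b P (Suc i)) mod (b - a + 1)"
            by (simp add: m_def)
          then have "head_pos k x a b P i = head_pos k x a b P (Suc i)"
            by (rule mod_eq_imp_eq[OF head_pos_range[OF ab] head_pos_range[OF ab]])
          then have "belt_pos x a b (P i) = belt_pos x a b (P (Suc i))"
          proof -
            have "i < k" "Suc i < k" using i j by simp_all
            then show ?thesis using \<open>head_pos k x a b P i = _\<close> i pr[of i] pr[of "Suc i"]
              by (simp add: head_pos_def)
          qed
          moreover have "P i \<in> {a..b}" "P (Suc i) \<in> {a..b}" using pr i by simp_all
          ultimately show ?thesis using belt_pos_inj[OF B, of "P i" "P (Suc i)"] by simp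
        qed
        have "P i = P 0" if "i < j" for i
          using that
        proof (induction i)
          case (Suc i)
          then show ?case using st[of i] by simp
        qed simp
        moreover have "P 0 \<in> {a..b}" using pr by simp
        ultimately show False using False by blast
      qed
      then have "v[j - 1 := (v ! (j - 1) + e) mod m] ! i = v ! i" if "\<forall>l\<le>i. P l \<in> {a..b}" for i
        using that by (metis nth_list_update_neq)
      then show ?thesis unfolding P' st using R zero by (auto simp: has_coordinates_def)
    next
      case False
      then show ?thesis unfolding P' st using R by auto
    qed
  qed
qed

lemma heads_step_active:
  assumes B: "belt k x a b" and j: "1 \<le> j" "j \<le> k" and I: "same_active_heads k a b P0 P"
  shows "same_active_heads k a b P0 (heads_step j a b (belt_next k \<epsilon> x) P)"
proof (cases "(\<forall>i<j. P i = P 0) \<and> P 0 \<in> {a..b}")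
  case True
  define q where "q = belt_next k \<epsilon> x (P 0)"
  have P0: "P 0 \<in> {a..b}" using True by blast
  then have q: "q \<in> {a..b}" using belt_next_in_belt[OF B, of "P 0"] by (simp add: q_def)
  have P': "heads_step j a b (belt_next k \<epsilon> x) P = (\<lambda>i. if i < j then q else P i)"
    unfolding heads_step_def q_def if_P[OF True] ..
  have pr: "P i \<in> {a..b}" if "i < j" for i using True that by metis
  have "P0 l \<in> {a..b}" if "l \<le> i" "i < j" for l i
    using I pr[of l] that j by (auto simp: same_active_heads_def)
  then show ?thesis unfolding P' using I q pr j unfolding same_active_heads_def
    by (metis (no_types, lifting))
next
  case False
  show ?thesis unfolding heads_step_def if_not_P[OF False] by (rule I)
qed

lemma belt_cong: "(\<And>c. belt_break k x c = belt_break k y c) \<Longrightarrow> belt k x a b = belt k y a b"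
  by (simp add: belt_def)

lemma belt_next_cong:
  assumes "\<And>c. belt_break k x c = belt_break k y c" "\<And>c. fst (x c) = fst (y c)"
  shows "belt_next k \<epsilon> x = belt_next k \<epsilon> y"
  by (rule ext) (simp add: belt_next_def assms)

lemma ca_step_belt_alphabet:
  assumes "\<And>c. x c \<in> belt_alphabet k" "fst s \<le> k"
  shows "ca_step k s x c \<in> belt_alphabet k"
  using assms(1)[of c] assms(2) by (auto simp: belt_alphabet_def ca_step_def sgn_if)

text \<open>The invariant of a run of moves that starts in \<open>x0\<close>, where the belt from \<open>a\<close> to \<open>b\<close> has its heads at \<open>P0\<close>, and
reaches \<open>x\<close>, while the corresponding generators turn a tuple shown by \<open>x0\<close> into \<open>v\<close>.  Since cuts and parities are those of \<open>x0\<close>, positions on the belt may be computed in \<open>x0\<close>.\<close>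

definition simulates :: "nat \<Rightarrow> (int \<Rightarrow> column) \<Rightarrow> int \<Rightarrow> int \<Rightarrow> (nat \<Rightarrow> int) \<Rightarrow> (int \<Rightarrow> column) \<Rightarrow> int list \<Rightarrow> bool" where
  "simulates k x0 a b P0 x v \<longleftrightarrow>
     (\<forall>c. x c \<in> belt_alphabet k \<and> belt_break k x c = belt_break k x0 c \<and> fst (x c) = fst (x0 c)) \<and>
     (\<exists>P. has_heads k x a b P \<and> has_coordinates k x0 a b P v \<and> same_active_heads k a b P0 P)"

lemma simulates_step:
  assumes F: "breaks_outside_window k x0" and B: "belt k x0 a b" and S: "simulates k x0 a b P0 x v"
    and s: "1 \<le> fst s" "fst s \<le> k"
  shows "simulates k x0 a b P0 (ca_step k s x) (tuple_step (nat (b - a + 1)) s v)"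
proof -
  obtain P where P: "has_heads k x a b P" "has_coordinates k x0 a b P v" "same_active_heads k a b P0 P"
    and c: "\<And>c. x c \<in> belt_alphabet k" "\<And>c. belt_break k x c = belt_break k x0 c" "\<And>c. fst (x c) = fst (x0 c)"
    using S by (auto simp: simulates_def)
  have F': "breaks_outside_window k x" using F c(2) by (simp add: breaks_outside_window_def)
  have B': "belt k x a b" using B belt_cong[OF c(2)] by simp
  have n: "belt_next k (snd s) x = belt_next k (snd s) x0" by (rule belt_next_cong[OF c(2,3)])
  let ?P = "heads_step (fst s) a b (belt_next k (snd s) x0) P"
  have "has_heads k (ca_step k s x) a b ?P"
    using ca_step_has_heads[OF B' P(1) s] by (simp only: n)
  moreover have "has_coordinates k x0 a b ?P (tuple_step (nat (b - a + 1)) s v)"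
    using heads_step_coordinates[OF B s P(2), of "snd s"] by simp
  moreover have "same_active_heads k a b P0 ?P"
    by (rule heads_step_active[OF B s P(3)])
  moreover have "ca_step k s x c \<in> belt_alphabet k \<and> belt_break k (ca_step k s x) c = belt_break k x0 c \<and> fst (ca_step k s x c) = fst (x0 c)" for c
    using ca_step_belt_alphabet[OF c(1) s(2)] ca_step_belt_break[OF F' c(1) s] c by simp
  ultimately show ?thesis unfolding simulates_def by blast
qed

lemma simulates_word:
  assumes "breaks_outside_window k x0" "belt k x0 a b" "simulates k x0 a b P0 x v" "set w \<subseteq> letters k"
  shows "simulates k x0 a b P0 (foldr (ca_step k) w x) (foldr (tuple_step (nat (b - a + 1))) w v)"
  using assms(4)
proof (induction w)
  case Nil then show ?case using assms(3) by simp
next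
  case (Cons s w)
  then show ?case using simulates_step[OF assms(1,2)] by (auto simp: letters_def)
qed

text \<open>The coordinates determine the position of every head from that of the following one.  Working downwards from the pinned
head or from the first missing one, which has not moved, this recovers all positions.\<close>

lemma same_coordinates_imp_same_heads:
  assumes B: "belt k x a b" and R: "has_coordinates k x a b P v" "has_coordinates k x a b P0 v" and S: "same_active_heads k a b P0 P"
    and i: "i < k"
  shows "P i = P0 i"
  using i
proof (induction "k - i" arbitrary: i rule: less_induct)
  case less
  have ab: "a \<le> b" using B by (simp add: belt_def)
  show ?case
  proof (cases "\<forall>l\<le>i. P0 l \<in> {a..b}")
    case False
    then show ?thesis using S less.prems by (auto simp: same_active_heads_def)
  next
    case True
    then have True': "\<forall>l\<le>i. P l \<in> {a..b}" using S less.prems by (auto simp: same_active_heads_def)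
    have "head_pos k x a b P (Suc i) = head_pos k x a b P0 (Suc i)"
    proof (cases "Suc i < k")
      case True
      then show ?thesis using S less.hyps[of "Suc i"] by (auto simp: head_pos_def)
    qed (simp add: head_pos_def)
    moreover have "(head_pos k x a b P i - head_pos k x a b P (Suc i)) mod (b - a + 1) =
        (head_pos k x a b P0 i - head_pos k x a b P0 (Suc i)) mod (b - a + 1)"
      using R True True' less.prems by (auto simp: has_coordinates_def)
    ultimately have "head_pos k x a b P i = head_pos k x a b P0 i"
      using mod_eq_imp_eq[OF head_pos_range[OF ab] head_pos_range[OF ab]] by metis
    then show ?thesis using True True' less.prems belt_pos_inj[OF B, of "P i" "P0 i"]
      by (auto simp: head_pos_def)
  qed
qed

lemma ca_word_identity_breaks:
  assumes w: "set w \<subseteq> letters k" and T: "\<And>m. 1 \<le> m \<Longrightarrow> tuple_identity k m w"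
    and F: "breaks_outside_window k x" and X: "\<And>c. x c \<in> belt_alphabet k"
  shows "foldr (ca_step k) w x c = x c"
proof -
  obtain a b where B: "belt k x a b" and c: "a \<le> c" "c \<le> b" using belt_exists[OF F] by blast
  have ab: "a \<le> b" using c by simp
  define m where "m = b - a + 1"
  obtain P0 where P0: "has_heads k x a b P0" using belt_has_heads[OF B X] by blast
  define v where "v = map (\<lambda>i. (head_pos k x a b P0 i - head_pos k x a b P0 (Suc i)) mod m) [0..<k]"
  have R0: "has_coordinates k x a b P0 v" by (simp add: has_coordinates_def v_def m_def)
  have "simulates k x a b P0 x v" using X P0 R0 by (auto simp: simulates_def same_active_heads_def)
  then have "simulates k x a b P0 (foldr (ca_step k) w x) (foldr (tuple_step (nat (b - a + 1))) w v)"
    by (rule simulates_word[OF F B _ w])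
  moreover have "foldr (tuple_step (nat (b - a + 1))) w v = v"
  proof -
    have m: "0 < m" "int (nat m) = m" using ab by (simp_all add: m_def)
    have "set v \<subseteq> {0..<m}" using m(1) by (auto simp: v_def)
    moreover have "tuple_identity k (nat m) w" using T m by simp
    ultimately show ?thesis using m unfolding m_def[symmetric] tuple_identity_def by (simp add: v_def)
  qed
  ultimately have S: "simulates k x a b P0 (foldr (ca_step k) w x) v" by simp
  define y where "y = foldr (ca_step k) w x"
  obtain P where P: "has_heads k y a b P" "has_coordinates k x a b P v" "same_active_heads k a b P0 P"
    and y: "y c \<in> belt_alphabet k" "fst (y c) = fst (x c)" using S by (auto simp: simulates_def y_def)
  have "snd (y c) i = snd (x c) i" for i
  proof (cases "i < k")
    case True
    have "P i = P0 i" by (rule same_coordinates_imp_same_heads[OF B P(2) R0 P(3) True])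
    then show ?thesis using P(1) P0 True c by (auto simp: has_heads_def)
  next
    case False
    then show ?thesis using y(1) X[of c] by (auto simp: belt_alphabet_def)
  qed
  then show ?thesis using y(2) by (auto simp: y_def[symmetric] prod_eq_iff)
qed

lemma belt_break_local:
  assumes "x c = y c" "x (c + 1) = y (c + 1)"
  shows "belt_break k x c = belt_break k y c"
  using assms by (simp add: belt_break_def)

text \<open>The stack is at distance at most \<open>2\<close>, and finding its next cell requires the breaks up to distance \<open>2\<close> from it.\<close>

lemma ca_step_local:
  assumes "\<And>d. \<bar>d - c\<bar> \<le> 4 \<Longrightarrow> x d = y d"
  shows "ca_step k s x c = ca_step k s y c"
proof -
  have br: "belt_break k x d = belt_break k y d" if "\<bar>d - c\<bar> \<le> 4" "\<bar>d + 1 - c\<bar> \<le> 4" for d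
    using belt_break_local[of x d y k] assms that by blast
  have fn: "full_near k j x c d = full_near k j y c d" for j d
  proof (cases "\<bar>d - c\<bar> \<le> 2")
    case True
    then have "linked k x c d = linked k y c d" unfolding linked_def
      by (intro iff_allI imp_cong refl) (subst br; auto simp: min_def max_def split: if_splits)
    then show ?thesis using True assms[of d] by (simp add: full_near_def)
  qed (simp add: full_near_def)
  have nx: "belt_next k \<epsilon> x d = belt_next k \<epsilon> y d" if "\<bar>d - c\<bar> \<le> 2" for d \<epsilon>
  proof -
    have "belt_break k x d = belt_break k y d" "belt_break k x (d + 1) = belt_break k y (d + 1)" "belt_break k x (d - 1) = belt_break k y (d - 1)"
      "belt_break k x (d - 2) = belt_break k y (d - 2)" by (rule br; use that in linarith)+
    moreover have "x d = y d" using assms that by simp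
    ultimately show ?thesis by (simp add: belt_next_def)
  qed
  have nx': "belt_next k \<epsilon> x (c + (SOME e. full_near k j y c (c + e))) = belt_next k \<epsilon> y (c + (SOME e. full_near k j y c (c + e)))"
    if "\<exists>d. full_near k j y c d" for \<epsilon> j
  proof -
    have "\<exists>e. full_near k j y c (c + e)" using that by (metis add_diff_cancel_left' diff_add_cancel add.commute)
    from someI_ex[OF this] show ?thesis by (intro nx) (simp add: full_near_def)
  qed
  have "x c = y c" using assms by simp
  then show ?thesis unfolding ca_step_def fn using nx' by (auto simp: fun_eq_iff)
qed

lemma ca_word_local:
  assumes "\<And>d. \<bar>d - c\<bar> \<le> 4 * int (length w) \<Longrightarrow> x d = y d"
  shows "foldr (ca_step k) w x c = foldr (ca_step k) w y c"
  using assms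
proof (induction w arbitrary: c)
  case Nil then show ?case by simp
next
  case (Cons s w)
  have "foldr (ca_step k) w x d = foldr (ca_step k) w y d" if "\<bar>d - c\<bar> \<le> 4" for d
    by (rule Cons.IH, rule Cons.prems) (use that in auto)
  then have "ca_step k s (foldr (ca_step k) w x) c = ca_step k s (foldr (ca_step k) w y) c"
    by (rule ca_step_local)
  then show ?case by simp
qed

text \<open>Outside of the window that the word can see from \<open>c\<close>, constant columns replace the configuration.  Equal parities cut
the line between all of them, so that all belts become finite.\<close>

lemma ca_word_identity:
  assumes w: "set w \<subseteq> letters k" and T: "\<And>m. 1 \<le> m \<Longrightarrow> tuple_identity k m w"
    and X: "\<And>c. x c \<in> belt_alphabet k"
  shows "foldr (ca_step k) w x = x"
proof
  fix c
  define N where "N = 4 * int (length w)"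
  \<comment> \<open>constant parity outside of the window forces breaks there\<close>
  define y where "y d = (if \<bar>d - c\<bar> \<le> N then x d else (True, \<lambda>_. 0))" for d
  have "belt_break k y d" if "\<bar>c\<bar> + N + 2 \<le> \<bar>d\<bar>" for d
    using that by (auto simp: y_def belt_break_def)
  then have "breaks_outside_window k y" by (auto simp: breaks_outside_window_def)
  moreover have "y d \<in> belt_alphabet k" for d using X by (auto simp: y_def belt_alphabet_def)
  ultimately have "foldr (ca_step k) w y c = y c" using ca_word_identity_breaks[OF w] T by blast
  moreover have "foldr (ca_step k) w x c = foldr (ca_step k) w y c"
    by (rule ca_word_local) (simp add: y_def N_def)
  moreover have "y c = x c" by (simp add: y_def N_def)
  ultimately show "foldr (ca_step k) w x c = x c" by simp
qed

text \<open>A belt of length \<open>m\<close> is prepared whose heads show the tuple \<open>v\<close>.  As the word does not move the heads, the tuple that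
they show after the word, which is the image of \<open>v\<close>, equals \<open>v\<close>.\<close>

lemma tuple_identity_of_ca_word:
  assumes w: "set w \<subseteq> letters k" and I: "\<And>x. (\<And>c. x c \<in> belt_alphabet k) \<Longrightarrow> foldr (ca_step k) w x = x"
    and m: "1 \<le> m"
  shows "tuple_identity k m w"
  unfolding tuple_identity_def
proof (intro allI impI, elim conjE)
  fix v :: "int list"
  assume len: "length v = k" and "m \<noteq> 0 \<longrightarrow> set v \<subseteq> {0..<int m}"
  then have v: "v ! i \<in> {0..<int m}" if "i < k" for i using that m by (auto simp: subset_iff)
  define b where "b = int m - 1"
  have b: "0 \<le> b" "b - 0 + 1 = int m" using m by (auto simp: b_def)
  \<comment> \<open>the outer columns repeat the parity of the nearest column of the belt, which cuts the line at both ends of the belt\<close>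
  define conf :: "(nat \<Rightarrow> int) \<Rightarrow> int \<Rightarrow> column" where
    "conf P d = (if d < 0 then True else if d \<le> b then even d else even b,
              \<lambda>i. if i < k \<and> 0 \<le> d \<and> d \<le> b then sgn (d - P i) else 0)" for P d
  have conf_belt: "belt k (conf P) 0 b" for P
    using b(1) by (auto simp: belt_def belt_break_def conf_def compatible_marks_def sgn_if)
  have conf_pos: "belt_pos (conf P) 0 b = belt_pos (conf Q) 0 b" for P Q
    by (rule ext) (simp add: belt_pos_def conf_def)
  \<comment> \<open>the position of head \<open>i\<close>: the coordinates telescope from head \<open>i\<close> to the pinned head \<open>k\<close>\<close>
  define S where "S i = (\<Sum>l\<in>{i..<k}. v ! l)" for i
  have "\<exists>p. 0 \<le> p \<and> p \<le> b \<and> belt_pos (conf (\<lambda>_. 0)) 0 b p = S i mod int m" for i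
    by (rule belt_pos_surj[OF conf_belt]) (use b m in auto)
  then obtain P where P: "\<And>i. 0 \<le> P i \<and> P i \<le> b \<and> belt_pos (conf (\<lambda>_. 0)) 0 b (P i) = S i mod int m"
    by metis
  define x where "x = conf P"
  have Ppos: "belt_pos x 0 b (P i) = S i mod int m" for i using P conf_pos[of P "\<lambda>_. 0"] by (simp add: x_def)
  have B: "belt k x 0 b" by (simp add: x_def conf_belt)
  have xc: "x c \<in> belt_alphabet k" for c by (auto simp: x_def conf_def belt_alphabet_def sgn_if)
  have F: "breaks_outside_window k x" unfolding breaks_outside_window_def
    using b(1) by (intro exI[of _ "b + 2"]) (auto simp: belt_break_def x_def conf_def)
  have P_range: "0 \<le> P i" "P i \<le> b" "- 1 \<le> P i" "P i \<le> b + 1" for i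
    using conjunct1[OF P[of i]] conjunct1[OF conjunct2[OF P[of i]]] by simp_all
  have rd: "has_heads k x 0 b P" using P_range by (auto simp: has_heads_def x_def conf_def)
  have hp: "head_pos k x 0 b P i = S i mod int m" if "i \<le> k" for i
    using that P_range Ppos by (auto simp: head_pos_def S_def)
  have form: "v ! i = (head_pos k x 0 b P i - head_pos k x 0 b P (Suc i)) mod int m" if "i < k" for i
  proof -
    have "S i = v ! i + S (Suc i)" using that by (simp add: S_def sum.atLeast_Suc_lessThan)
    then have "(S i mod int m - S (Suc i) mod int m) mod int m = v ! i mod int m" by (simp add: mod_simps)
    then show ?thesis using hp[of i] hp[of "Suc i"] that v[OF that] by simp
  qed
  have R: "has_coordinates k x 0 b P v" unfolding has_coordinates_def using len form b by auto
  have "simulates k x 0 b P x v" using xc rd R by (auto simp: simulates_def same_active_heads_def)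
  then have "simulates k x 0 b P (foldr (ca_step k) w x) (foldr (tuple_step (nat (b - 0 + 1))) w v)"
    by (rule simulates_word[OF F B _ w])
  then have "simulates k x 0 b P x (foldr (tuple_step m) w v)" using I[OF xc] b by simp
  then obtain P' where P': "has_heads k x 0 b P'" "has_coordinates k x 0 b P' (foldr (tuple_step m) w v)"
    by (auto simp: simulates_def)
  have PP: "P' i = P i" if "i < k" for i
  proof -
    have "P i \<in> {0..b}" using P_range[of i] by simp
    then have "snd (x (P i)) i = sgn (P i - P i)" "snd (x (P i)) i = sgn (P i - P' i)"
      using rd P'(1) that unfolding has_heads_def by blast+
    then have "sgn (P i - P' i) = sgn (P i - P i)" by simp
    then show ?thesis by (simp add: sgn_if split: if_splits)
  qed
  have hh: "head_pos k x 0 b P' i = head_pos k x 0 b P i" for i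
    by (cases "i < k") (simp_all add: PP head_pos_def)
  show "foldr (tuple_step m) w v = v"
  proof (rule nth_equalityI)
    show "length (foldr (tuple_step m) w v) = length v" using P'(2) len by (simp add: has_coordinates_def)
    fix i assume "i < length (foldr (tuple_step m) w v)"
    then have i: "i < k" using P'(2) by (simp add: has_coordinates_def)
    then have "\<forall>l\<le>i. P' l \<in> {0..b}" using PP P_range by auto
    then show "foldr (tuple_step m) w v ! i = v ! i"
      using P'(2) i form[OF i] b hh by (auto simp: has_coordinates_def)
  qed
qed

section \<open>Block maps as automorphisms of the full shift\<close>

lemma topspace_full_shift: "topspace (full_shift \<Sigma>) = {x. \<forall>c. x c \<in> \<Sigma>}"
  by (auto simp: full_shift_def PiE_def Pi_def)

lemma group_ShiftAutGroup: "group (ShiftAutGroup \<Sigma>)"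
proof -
  let ?T = "full_shift \<Sigma>" and ?B = "BijGroup (topspace (full_shift \<Sigma>))"
  interpret B: group ?B by (rule group_BijGroup)
  have sh: "shift x \<in> topspace ?T" if "x \<in> topspace ?T" for x
    using that by (simp add: topspace_full_shift shift_def)
  have "subgroup (shift_aut \<Sigma>) ?B"
  proof (rule B.subgroupI)
    show "shift_aut \<Sigma> \<subseteq> carrier ?B" by (auto simp: shift_aut_def BijGroup_def)
    have "homeomorphic_map ?T ?T (\<lambda>x\<in>topspace ?T. x)"
      by (rule homeomorphic_map_eq[of _ _ id]) auto
    then have "(\<lambda>x\<in>topspace ?T. x) \<in> shift_aut \<Sigma>"
      using sh by (auto simp: shift_aut_def id_Bij)
    then show "shift_aut \<Sigma> \<noteq> {}" by blast
  next
    fix f assume f: "f \<in> shift_aut \<Sigma>"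
    then have fB: "f \<in> Bij (topspace ?T)" and fh: "homeomorphic_map ?T ?T f"
      and fs: "\<And>x. x \<in> topspace ?T \<Longrightarrow> f (shift x) = shift (f x)"
      by (auto simp: shift_aut_def)
    define g where "g = (\<lambda>x\<in>topspace ?T. inv_into (topspace ?T) f x)"
    have ginv: "inv\<^bsub>?B\<^esub> f = g" unfolding g_def by (rule inv_BijGroup[OF fB])
    have bij: "bij_betw f (topspace ?T) (topspace ?T)" using fB by (simp add: Bij_def)
    have gf: "g (f x) = x" if "x \<in> topspace ?T" for x
      using that bij bij_betwE[OF bij] by (simp add: g_def bij_betw_inv_into_left)
    have fg: "f (g x) = x" "g x \<in> topspace ?T" if "x \<in> topspace ?T" for x
      using that bij by (auto simp: g_def bij_betw_inv_into_right bij_betw_def inv_into_into)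
    obtain g' where g': "homeomorphic_maps ?T ?T f g'" using fh homeomorphic_map_maps by blast
    have "g' x = g x" if "x \<in> topspace ?T" for x
      using g' fg[OF that] unfolding homeomorphic_maps_def by metis
    then have "homeomorphic_map ?T ?T g"
      using g' homeomorphic_maps_sym homeomorphic_maps_imp_map homeomorphic_map_eq by metis
    moreover have "g (shift x) = shift (g x)" if "x \<in> topspace ?T" for x
      using gf[OF sh[OF fg(2)[OF that]]] fs[OF fg(2)[OF that]] fg(1)[OF that] by simp
    moreover have "g \<in> Bij (topspace ?T)" unfolding g_def by (rule restrict_inv_into_Bij[OF fB])
    ultimately show "inv\<^bsub>?B\<^esub> f \<in> shift_aut \<Sigma>" unfolding ginv shift_aut_def by blast
  next
    fix f g assume "f \<in> shift_aut \<Sigma>" "g \<in> shift_aut \<Sigma>"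
    then have f: "f \<in> Bij (topspace ?T)" "homeomorphic_map ?T ?T f" "\<And>x. x \<in> topspace ?T \<Longrightarrow> f (shift x) = shift (f x)"
      and g: "g \<in> Bij (topspace ?T)" "homeomorphic_map ?T ?T g" "\<And>x. x \<in> topspace ?T \<Longrightarrow> g (shift x) = shift (g x)"
      by (auto simp: shift_aut_def)
    have gt: "g x \<in> topspace ?T" if "x \<in> topspace ?T" for x using Bij_imp_funcset[OF g(1)] that by auto
    have "homeomorphic_map ?T ?T (compose (topspace ?T) f g)"
      by (rule homeomorphic_map_eq[OF homeomorphic_map_compose[OF g(2) f(2)]]) (simp add: compose_def)
    then have "compose (topspace ?T) f g \<in> shift_aut \<Sigma>"
      using f g gt sh compose_Bij[OF f(1) g(1)] by (auto simp: shift_aut_def compose_def)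
    then show "f \<otimes>\<^bsub>?B\<^esub> g \<in> shift_aut \<Sigma>" using f g by (simp add: BijGroup_def)
  qed
  then show ?thesis unfolding ShiftAutGroup_def by (rule B.subgroup_imp_group)
qed

text \<open>A coordinate of the image depends on finitely many coordinates only, hence is constant on a cylinder around each point.\<close>

lemma continuous_map_full_shift:
  assumes F: "\<And>x. x \<in> topspace (full_shift \<Sigma>) \<Longrightarrow> F x \<in> topspace (full_shift \<Sigma>)"
    and loc: "\<And>x y c. x \<in> topspace (full_shift \<Sigma>) \<Longrightarrow> y \<in> topspace (full_shift \<Sigma>) \<Longrightarrow>
      (\<And>d. \<bar>d - c\<bar> \<le> r \<Longrightarrow> x d = y d) \<Longrightarrow> F x c = F y c"
  shows "continuous_map (full_shift \<Sigma>) (full_shift \<Sigma>) F"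
proof -
  have "continuous_map (full_shift \<Sigma>) (discrete_topology \<Sigma>) (\<lambda>x. F x c)" for c
  proof (rule continuous_map_openin_preimage_eq[THEN iffD2], intro conjI allI impI)
    show "(\<lambda>x. F x c) \<in> topspace (full_shift \<Sigma>) \<rightarrow> topspace (discrete_topology \<Sigma>)"
      using F by (auto simp: topspace_full_shift)
    fix U
    show "openin (full_shift \<Sigma>) (topspace (full_shift \<Sigma>) \<inter> (\<lambda>x. F x c) -` U)"
    proof (subst openin_subopen, intro ballI)
      fix x assume x: "x \<in> topspace (full_shift \<Sigma>) \<inter> (\<lambda>x. F x c) -` U"
      define V where "V d = (if \<bar>d - c\<bar> \<le> r then {x d} else \<Sigma>)" for d
      have "{d. V d \<noteq> \<Sigma>} \<subseteq> {c - r..c + r}" by (auto simp: V_def)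
      then have "finite {d. V d \<noteq> \<Sigma>}" by (rule finite_subset) simp
      moreover have V: "V d \<subseteq> \<Sigma>" for d using x by (auto simp: V_def topspace_full_shift)
      ultimately have "openin (full_shift \<Sigma>) (\<Pi>\<^sub>E d\<in>UNIV. V d)"
        unfolding full_shift_def by (intro product_topology_basis) auto
      moreover have "x \<in> (\<Pi>\<^sub>E d\<in>UNIV. V d)" using x by (auto simp: V_def topspace_full_shift)
      moreover have "(\<Pi>\<^sub>E d\<in>UNIV. V d) \<subseteq> topspace (full_shift \<Sigma>) \<inter> (\<lambda>x. F x c) -` U"
      proof
        fix y assume "y \<in> (\<Pi>\<^sub>E d\<in>UNIV. V d)"
        then have y: "y d \<in> V d" for d by auto
        then have yt: "y \<in> topspace (full_shift \<Sigma>)" using V by (auto simp: topspace_full_shift)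
        have "y d = x d" if "\<bar>d - c\<bar> \<le> r" for d using y[of d] that by (simp add: V_def)
        then have "F y c = F x c" using loc[OF yt] x by blast
        then show "y \<in> topspace (full_shift \<Sigma>) \<inter> (\<lambda>x. F x c) -` U" using x yt by simp
      qed
      ultimately show "\<exists>T. openin (full_shift \<Sigma>) T \<and> x \<in> T \<and> T \<subseteq> topspace (full_shift \<Sigma>) \<inter> (\<lambda>x. F x c) -` U"
        by blast
    qed
  qed
  then show ?thesis
    by (subst (2) full_shift_def) (simp add: continuous_map_componentwise_UNIV)
qed

lemma restrict_in_shift_aut:
  assumes F: "\<And>x. x \<in> topspace (full_shift \<Sigma>) \<Longrightarrow> F x \<in> topspace (full_shift \<Sigma>)"
    and G: "\<And>x. x \<in> topspace (full_shift \<Sigma>) \<Longrightarrow> G x \<in> topspace (full_shift \<Sigma>)"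
    and GF: "\<And>x. x \<in> topspace (full_shift \<Sigma>) \<Longrightarrow> G (F x) = x"
    and FG: "\<And>x. x \<in> topspace (full_shift \<Sigma>) \<Longrightarrow> F (G x) = x"
    and cont: "continuous_map (full_shift \<Sigma>) (full_shift \<Sigma>) F" "continuous_map (full_shift \<Sigma>) (full_shift \<Sigma>) G"
    and comm: "\<And>x. x \<in> topspace (full_shift \<Sigma>) \<Longrightarrow> F (shift x) = shift (F x)"
  shows "restrict F (topspace (full_shift \<Sigma>)) \<in> shift_aut \<Sigma>"
proof -
  let ?T = "full_shift \<Sigma>"
  have sh: "shift x \<in> topspace ?T" if "x \<in> topspace ?T" for x
    using that by (simp add: topspace_full_shift shift_def)
  have "homeomorphic_maps ?T ?T F G" unfolding homeomorphic_maps_def using cont GF FG by blast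
  then have "homeomorphic_map ?T ?T F" by (rule homeomorphic_maps_imp_map)
  then have "homeomorphic_map ?T ?T (restrict F (topspace ?T))" by (rule homeomorphic_map_eq) simp
  moreover have "bij_betw F (topspace ?T) (topspace ?T)"
    by (rule bij_betw_byWitness[of _ G]) (use F G GF FG in auto)
  then have "restrict F (topspace ?T) \<in> Bij (topspace ?T)"
    by (simp add: Bij_def bij_betw_restrict_eq)
  ultimately show ?thesis using comm sh by (simp add: shift_aut_def)
qed

section \<open>The embedding\<close>

lemma finite_belt_alphabet: "finite (belt_alphabet k)"
proof (rule finite_subset)
  show "belt_alphabet k \<subseteq> (\<lambda>(b, f). (b, \<lambda>i. if i < k then f i else 0)) ` (UNIV \<times> ({..<k} \<rightarrow>\<^sub>E {-1, 0, 1}))"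
  proof
    fix s assume s: "s \<in> belt_alphabet k"
    then have "s = (\<lambda>(b, f). (b, \<lambda>i. if i < k then f i else 0)) (fst s, restrict (snd s) {..<k})"
      by (auto simp: belt_alphabet_def prod_eq_iff fun_eq_iff)
    moreover have "(fst s, restrict (snd s) {..<k}) \<in> UNIV \<times> ({..<k} \<rightarrow>\<^sub>E {-1, 0, 1})"
      using s by (auto simp: belt_alphabet_def)
    ultimately show "s \<in> (\<lambda>(b, f). (b, \<lambda>i. if i < k then f i else 0)) ` (UNIV \<times> ({..<k} \<rightarrow>\<^sub>E {-1, 0, 1}))"
      by (rule image_eqI)
  qed
  show "finite ((\<lambda>(b, f). (b, \<lambda>i. if i < k then f i else (0::int))) ` ((UNIV :: bool set) \<times> ({..<k} \<rightarrow>\<^sub>E {-1, 0, 1})))"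
    by (intro finite_imageI finite_cartesian_product finite_PiE) auto
qed

lemma card_belt_alphabet: "card (belt_alphabet k) \<ge> 2"
proof -
  have "{(True, \<lambda>_. 0), (False, \<lambda>_. 0)} \<subseteq> belt_alphabet k" by (auto simp: belt_alphabet_def)
  from card_mono[OF finite_belt_alphabet this] show ?thesis by simp
qed

lemma belt_break_shift: "belt_break k (shift x) c = belt_break k x (c + 1)"
  by (simp add: belt_break_def shift_def add.assoc add.commute)

lemma linked_shift: "linked k (shift x) c d = linked k x (c + 1) (d + 1)"
proof
  assume L: "linked k (shift x) c d"
  show "linked k x (c + 1) (d + 1)" unfolding linked_def
  proof (intro allI impI)
    fix e assume "min (c + 1) (d + 1) \<le> e \<and> e < max (c + 1) (d + 1)"
    then have "min c d \<le> e - 1 \<and> e - 1 < max c d" by linarith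
    then have "\<not> belt_break k (shift x) (e - 1)" using L by (auto simp: linked_def)
    then show "\<not> belt_break k x e" by (simp add: belt_break_shift)
  qed
next
  assume L: "linked k x (c + 1) (d + 1)"
  show "linked k (shift x) c d" unfolding linked_def
  proof (intro allI impI)
    fix e assume "min c d \<le> e \<and> e < max c d"
    then have "min (c + 1) (d + 1) \<le> e + 1 \<and> e + 1 < max (c + 1) (d + 1)" by linarith
    then have "\<not> belt_break k x (e + 1)" using L unfolding linked_def by blast
    then show "\<not> belt_break k (shift x) e" by (simp add: belt_break_shift)
  qed
qed

lemma full_near_shift: "full_near k j (shift x) c d = full_near k j x (c + 1) (d + 1)"
  by (simp add: full_near_def linked_shift) (simp add: shift_def)

lemma belt_next_shift: "belt_next k \<epsilon> (shift x) c = belt_next k \<epsilon> x (c + 1) - 1"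
proof -
  have "belt_break k (shift x) c = belt_break k x (c + 1)" "belt_break k (shift x) (c + 1) = belt_break k x (c + 1 + 1)"
    "belt_break k (shift x) (c - 1) = belt_break k x (c + 1 - 1)" "belt_break k (shift x) (c - 2) = belt_break k x (c + 1 - 2)"
    by (simp_all add: belt_break_shift)
  moreover have "shift x c = x (c + 1)" by (simp add: shift_def)
  ultimately show ?thesis unfolding belt_next_def by simp
qed

lemma ca_step_shift: "ca_step k s (shift x) = shift (ca_step k s x)"
proof (rule ext)
  fix c
  have ex: "(\<exists>d. full_near k j (shift x) c d) = (\<exists>d. full_near k j x (c + 1) d)" for j
    unfolding full_near_shift by (metis diff_add_cancel)
  have "full_near k j (shift x) c (c + e) = full_near k j x (c + 1) (c + 1 + e)" for j e
    by (simp add: full_near_shift algebra_simps)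
  then have so: "(SOME e. full_near k j (shift x) c (c + e)) = (SOME e. full_near k j x (c + 1) (c + 1 + e))" for j
    by simp
  have nx: "c - belt_next k \<epsilon> (shift x) (c + e) = c + 1 - belt_next k \<epsilon> x (c + 1 + e)" for \<epsilon> e
    by (simp add: belt_next_shift algebra_simps)
  have "shift x c = x (c + 1)" by (simp add: shift_def)
  then show "ca_step k s (shift x) c = shift (ca_step k s x) c"
    unfolding ca_step_def ex so nx by (simp add: shift_def cong: if_cong)
qed

lemma ca_word_belt_alphabet:
  "set w \<subseteq> letters k \<Longrightarrow> (\<And>c. x c \<in> belt_alphabet k) \<Longrightarrow> foldr (ca_step k) w x c \<in> belt_alphabet k"
proof (induction w arbitrary: c)
  case (Cons s w)
  then show ?case using ca_step_belt_alphabet[of "foldr (ca_step k) w x" k s] by (auto simp: letters_def)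
qed simp

text \<open>A move followed by its reverse is a word that acts trivially on all tuples.\<close>

lemma ca_step_cancel:
  assumes "1 \<le> i" "i \<le> k" "\<And>c. x c \<in> belt_alphabet k"
  shows "ca_step k (i, b) (ca_step k (i, \<not> b) x) = x"
proof -
  have "tuple_identity k m [(i, b), (i, \<not> b)]" if "1 \<le> m" for m
    using tuple_step_cancel[OF _ assms(1,2), of _ m b] that
    by (auto simp: tuple_identity_def residue_tuples_def carrier_integer_mod_group)
  from ca_word_identity[OF _ this assms(3)] show ?thesis using assms(1,2) by (simp add: letters_def)
qed

text \<open>Both sides say that the word acts trivially on \<open>(\<int>/n\<int>)\<^bsup>k+1\<^esup>\<close> for all \<open>n\<close>.\<close>

lemma words_in_K_hat_and_automaton:
  assumes w: "set w \<subseteq> letters (Suc k)"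
  shows "word_eval (product_group UNIV (\<lambda>n. K_grp n (Suc k))) (\<lambda>i n. K_gen n (Suc k) i) w =
      \<one>\<^bsub>product_group UNIV (\<lambda>n. K_grp n (Suc k))\<^esub> \<longleftrightarrow>
    (\<forall>x. (\<forall>c. x c \<in> belt_alphabet (Suc k)) \<longrightarrow> foldr (ca_step (Suc k)) w x = x)"
    (is "?L = ?R")
proof -
  have "word_eval (product_group UNIV (\<lambda>n. K_grp n (Suc k))) (\<lambda>i n. K_gen n (Suc k) i) w =
      (\<lambda>n. word_eval (K_grp n (Suc k)) (K_gen n (Suc k)) w)"
    by (rule word_eval_product_group[of _ "{1..Suc k}"])
      (use K_grp_faithful K_gen_act w in \<open>auto simp: letters_def\<close>)
  then have "?L \<longleftrightarrow> (\<forall>n. word_eval (K_grp n (Suc k)) (K_gen n (Suc k)) w = \<one>\<^bsub>K_grp n (Suc k)\<^esub>)"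
    by (simp add: fun_eq_iff del: K_grp.simps K_gen.simps)
  also have "\<dots> \<longleftrightarrow> (\<forall>n. tuple_identity (Suc k) n w)"
    using word_eval_K_grp_eq_one[OF w] by blast
  also have "\<dots> \<longleftrightarrow> ?R"
  proof
    assume "\<forall>n. tuple_identity (Suc k) n w"
    then show ?R using ca_word_identity[OF w] by blast
  next
    assume R: ?R
    have T: "tuple_identity (Suc k) n w" if "1 \<le> n" for n
      by (rule tuple_identity_of_ca_word[OF w _ that]) (use R in blast)
    show "\<forall>n. tuple_identity (Suc k) n w"
    proof
      fix n show "tuple_identity (Suc k) n w"
        using T tuple_identity_0[OF w T] by (cases "n = 0") auto
    qed
  qed
  finally show ?thesis .
qed

theorem theorem4:
  fixes k :: nat
  assumes "k \<ge> 1"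
  shows "embeds_in_shift_aut (K_hat k)"
proof -
  obtain k' where k: "k = Suc k'" using assms by (cases k) auto
  let ?P = "product_group UNIV (\<lambda>n. K_grp n k)"
  have P: "group ?P" using K_grp_faithful by (simp add: k del: K_grp.simps)
  obtain e :: "column \<Rightarrow> nat" where e: "inj_on e (belt_alphabet k)"
    using finite_imp_inj_to_nat_seg[OF finite_belt_alphabet] by blast
  define \<Sigma> where "\<Sigma> = e ` belt_alphabet k"
  define d where "d = inv_into (belt_alphabet k) e"
  let ?T = "topspace (full_shift \<Sigma>)"
  have de: "d (e s) = s" if "s \<in> belt_alphabet k" for s using that e by (simp add: d_def)
  have ed: "e (d a) = a" "d a \<in> belt_alphabet k" if "a \<in> \<Sigma>" for a
    using that by (auto simp: d_def \<Sigma>_def f_inv_into_f inv_into_into)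
  \<comment> \<open>\<open>enc\<close> and \<open>dec\<close> carry configurations over to the alphabet \<open>\<Sigma>\<close> of natural numbers and back\<close>
  define dec :: "(int \<Rightarrow> nat) \<Rightarrow> int \<Rightarrow> column" where "dec y = (\<lambda>c. d (y c))" for y
  define enc :: "(int \<Rightarrow> column) \<Rightarrow> int \<Rightarrow> nat" where "enc x = (\<lambda>c. e (x c))" for x
  have dec: "dec y c \<in> belt_alphabet k" "enc (dec y) = y" if "y \<in> ?T" for y c
    using that ed by (auto simp: dec_def enc_def topspace_full_shift)
  have enc: "enc x \<in> ?T" "dec (enc x) = x" if "\<And>c. x c \<in> belt_alphabet k" for x
    using that de by (auto simp: dec_def enc_def topspace_full_shift \<Sigma>_def)
  define F where "F s y = enc (ca_step k s (dec y))" for s y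
  have stepc: "ca_step k s x c \<in> belt_alphabet k" if "s \<in> letters k" "\<And>c. x c \<in> belt_alphabet k" for s x c
    using that ca_step_belt_alphabet[of x k s c] by (auto simp: letters_def)
  have FT: "F s y \<in> ?T" if "s \<in> letters k" "y \<in> ?T" for s y
    unfolding F_def by (intro enc(1) stepc that dec)
  have cancel: "F (i, b) (F (i, \<not> b) y) = y" if "i \<in> {1..k}" "y \<in> ?T" for i b y
  proof -
    have "dec (F (i, \<not> b) y) = ca_step k (i, \<not> b) (dec y)"
      unfolding F_def using that by (intro enc(2) stepc dec) (auto simp: letters_def)
    then show ?thesis
      using ca_step_cancel[of i k "dec y" b] that dec by (simp add: F_def)
  qed
  have cont: "continuous_map (full_shift \<Sigma>) (full_shift \<Sigma>) (F s)" if "s \<in> letters k" for s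
  proof (rule continuous_map_full_shift[where r = 4])
    fix x y :: "int \<Rightarrow> nat" and c assume "\<And>d. \<bar>d - c\<bar> \<le> 4 \<Longrightarrow> x d = y d"
    then have "ca_step k s (dec x) c = ca_step k s (dec y) c"
      by (intro ca_step_local) (simp add: dec_def)
    then show "F s x c = F s y c" by (simp add: F_def enc_def)
  qed (rule FT[OF that])
  have comm: "F s (shift y) = shift (F s y)" for s y
  proof -
    have "dec (shift y) = shift (dec y)" by (simp add: dec_def shift_def)
    then show ?thesis unfolding F_def by (simp add: ca_step_shift) (simp add: enc_def shift_def)
  qed
  let ?H = "ShiftAutGroup \<Sigma>"
  define h where "h b i = restrict (F (i, b)) ?T" for b i
  have hH: "h b i \<in> shift_aut \<Sigma>" if "i \<in> {1..k}" for b i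
    unfolding h_def
    by (rule restrict_in_shift_aut[where G = "F (i, \<not> b)"])
      (use that FT cancel[where i = i and b = b] cancel[where i = i and b = "\<not> b"] cont comm in \<open>auto simp: letters_def\<close>)
  have H: "group ?H" by (rule group_ShiftAutGroup)
  have carH: "carrier ?H = shift_aut \<Sigma>" by (simp add: ShiftAutGroup_def)
  have oneH: "\<one>\<^bsub>?H\<^esub> = (\<lambda>y\<in>?T. y)" by (simp add: ShiftAutGroup_def BijGroup_def)
  have multH: "f \<otimes>\<^bsub>?H\<^esub> g = compose ?T f g" if "f \<in> shift_aut \<Sigma>" "g \<in> shift_aut \<Sigma>" for f g
    using that by (simp add: ShiftAutGroup_def BijGroup_def shift_aut_def)
  have invH: "inv\<^bsub>?H\<^esub> (h True i) = h False i" if "i \<in> {1..k}" for i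
  proof (rule group.inv_equality[OF H])
    show "h True i \<in> carrier ?H" "h False i \<in> carrier ?H" using hH[OF that] carH by auto
    show "h False i \<otimes>\<^bsub>?H\<^esub> h True i = \<one>\<^bsub>?H\<^esub>"
      unfolding multH[OF hH[OF that] hH[OF that]] oneH
      using FT cancel[where i = i and b = False] that by (auto simp: compose_def h_def letters_def fun_eq_iff)
  qed
  have ev: "word_eval ?H (h True) w = (\<lambda>y\<in>?T. enc (foldr (ca_step k) w (dec y))) \<and>
      word_eval ?H (h True) w \<in> shift_aut \<Sigma>"
    if "set w \<subseteq> letters k" for w
    using that
  proof (induction w)
    case Nil
    have "\<one>\<^bsub>?H\<^esub> \<in> shift_aut \<Sigma>" using group.is_monoid[OF H, THEN monoid.one_closed] carH by simp
    moreover have "\<one>\<^bsub>?H\<^esub> = (\<lambda>y\<in>?T. enc (dec y))" unfolding oneH by (rule restrict_ext) (simp add: dec(2))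
    ultimately show ?case by (simp only: word_eval_Nil foldr.simps id_apply)
  next
    case (Cons s w)
    obtain i b where s: "s = (i, b)" "i \<in> {1..k}" using Cons.prems by (auto simp: letters_def)
    have IH: "word_eval ?H (h True) w = (\<lambda>y\<in>?T. enc (foldr (ca_step k) w (dec y)))"
      "word_eval ?H (h True) w \<in> shift_aut \<Sigma>" using Cons by auto
    have "word_eval ?H (h True) (s # w) = h b i \<otimes>\<^bsub>?H\<^esub> word_eval ?H (h True) w"
      using invH[OF s(2)] by (cases b) (simp_all add: s(1))
    then have W: "word_eval ?H (h True) (s # w) = compose ?T (h b i) (word_eval ?H (h True) w)"
      using multH[OF hH[OF s(2)] IH(2)] by simp
    have c: "foldr (ca_step k) w (dec y) c \<in> belt_alphabet k" if "y \<in> ?T" for y c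
      by (rule ca_word_belt_alphabet) (use Cons.prems dec(1)[OF that] in auto)
    have wT: "enc (foldr (ca_step k) w (dec y)) \<in> ?T"
        "dec (enc (foldr (ca_step k) w (dec y))) = foldr (ca_step k) w (dec y)" if "y \<in> ?T" for y
      by (rule enc, rule c[OF that])+
    have "compose ?T (h b i) (word_eval ?H (h True) w) = (\<lambda>y\<in>?T. enc (foldr (ca_step k) (s # w) (dec y)))"
      unfolding IH(1) compose_def h_def by (rule restrict_ext) (simp add: F_def s(1) wT)
    moreover have "word_eval ?H (h True) (s # w) \<in> shift_aut \<Sigma>"
      using group.is_monoid[OF H, THEN monoid.m_closed, of "h b i" "word_eval ?H (h True) w"] hH[OF s(2)] IH(2) carH
        multH[OF hH[OF s(2)] IH(2)] W by simp
    ultimately show ?case using W by metis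
  qed
  have "mon (subgroup_generated ?P ((\<lambda>i n. K_gen n k i) ` {1..k})) ?H \<noteq> {}"
  proof (rule mon_if_same_relations[OF P H])
    show "(\<lambda>i n. K_gen n k i) \<in> {1..k} \<rightarrow> carrier ?P"
      using K_gen_act[of _ k'] by (auto simp: k simp del: K_grp.simps K_gen.simps)
    show "h True \<in> {1..k} \<rightarrow> carrier ?H" using hH carH by auto
    fix w :: "(nat \<times> bool) list" assume "set w \<subseteq> {1..k} \<times> UNIV"
    then have w: "set w \<subseteq> letters k" by (simp add: letters_def)
    have "word_eval ?P (\<lambda>i n. K_gen n k i) w = \<one>\<^bsub>?P\<^esub> \<longleftrightarrow>
        (\<forall>x. (\<forall>c. x c \<in> belt_alphabet k) \<longrightarrow> foldr (ca_step k) w x = x)"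
      using words_in_K_hat_and_automaton[of w k'] w by (simp only: k)
    also have "\<dots> \<longleftrightarrow> (\<forall>y\<in>?T. enc (foldr (ca_step k) w (dec y)) = y)"
    proof
      assume "\<forall>x. (\<forall>c. x c \<in> belt_alphabet k) \<longrightarrow> foldr (ca_step k) w x = x"
      then show "\<forall>y\<in>?T. enc (foldr (ca_step k) w (dec y)) = y" using dec by simp
    next
      assume R: "\<forall>y\<in>?T. enc (foldr (ca_step k) w (dec y)) = y"
      show "\<forall>x. (\<forall>c. x c \<in> belt_alphabet k) \<longrightarrow> foldr (ca_step k) w x = x"
      proof (intro allI impI)
        fix x :: "int \<Rightarrow> column" assume x: "\<forall>c. x c \<in> belt_alphabet k"
        then have "enc (foldr (ca_step k) w x) = enc x" using R enc[of x] by force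
        then have "dec (enc (foldr (ca_step k) w x)) = dec (enc x)" by simp
        then show "foldr (ca_step k) w x = x"
          using enc(2)[of x] enc(2)[of "foldr (ca_step k) w x"] ca_word_belt_alphabet[OF w, of x] x by simp
      qed
    qed
    also have "\<dots> \<longleftrightarrow> word_eval ?H (h True) w = \<one>\<^bsub>?H\<^esub>"
      using ev[OF w] by (auto simp: oneH fun_eq_iff)
    finally show "word_eval ?P (\<lambda>i n. K_gen n k i) w = \<one>\<^bsub>?P\<^esub> \<longleftrightarrow> word_eval ?H (h True) w = \<one>\<^bsub>?H\<^esub>" .
  qed
  moreover have "group (K_hat k)" unfolding K_hat_def by (rule group.group_subgroup_generated[OF P])
  moreover have "finite \<Sigma>" "card \<Sigma> \<ge> 2"
    using finite_belt_alphabet card_belt_alphabet card_image[OF e] by (auto simp: \<Sigma>_def)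
  ultimately show ?thesis unfolding embeds_in_shift_aut_def K_hat_def by blast
qed

end
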